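(* Assume $q>2$, let $A=\mathbb{F}_q[T]$ and let $C$ be the Carlitz module. Let $m,u\in A$ be monic polynomials such that at least one of them has positive degree. Then there exists a large Zsigmondy prime for $(u,m)$, except exactly in the following cases: (EC-I) $q=3$, $u=1$, and $m=(\wp-1)\wp$ for an arbitrary monic prime $\wp$ of degree one in $\mathbb{F}_3[T]$; (EC-II) $q=4$, $u=1$, and $m=(\wp-1)\wp$ for an arbitrary monic prime $\wp$ of degree one in $\mathbb{F}_4[T]$; (EC-III) $q=3$, $u=1$, and $m\in\{(T-1)T^2,\ T(T+1)^2,\ (T+1)(T+2)^2\}$; (EC-IV) $q=3$ and $u=m\in\{T,\ T+1,\ T+2\}$; (EC-V) $q=5$, $u=1$, and $m\in\{T(T+1),\ (T+1)(T+2),\ (T+2)(T+3),\ (T+3)(T+4),\ (T+4)T\}$; (EC-VI) $u=1$ and $m$ is a monic prime of degree one in $\mathbb{F}_q[T]$ (any $q>2$); (EC-VII) $q=3$, $u=1$, and $m\in\{T^2,\ (T+1)^2,\ (T+2)^2\}$; (EC-VIII) $q=4$, $u=1$, and $m\in\{T(T+w),\ T(T+w^2),\ (T+1)(T+w),\ (T+1)(T+w^2)\}$, where $\mathbb{F}_4=\mathbb{F}_2(w)$ with $w^2+w+1=0$; (EC-IX) $q=3$, $u=1$, and $m=T^3+2T$.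
   Context: $A=\mathbb{F}_q[T]$, $k=\mathbb{F}_q(T)$. The Carlitz module is the $\mathbb{F}_q$-algebra homomorphism $a\mapsto C_a$ from $A$ to the twisted polynomial ring $k\langle\tau\rangle$ (with $\tau(x)=x^q$) determined by $C_T=T+\tau$; thus $C_T(x)=Tx+x^q$ and $C_a(x)\in A[x]$ for every $a\in A$, with $C_{ab}(x)=C_a(C_b(x))$. For nonzero $m,u\in A$, a Zsigmondy prime for $(u,m)$ is a monic prime $\wp\in A$ such that $C_m(u)\equiv 0\pmod{\wp}$ and $C_n(u)\not\equiv 0\pmod{\wp}$ for every nonzero $n\in A$ with $\deg(n)<\deg(m)$. A large Zsigmondy prime for $(u,m)$ is a Zsigmondy prime $\wp$ for $(u,m)$ such that either $\deg(\wp)>\deg(m)$ or $\wp^2$ divides $C_m(u)$. *)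

theory Defs
  imports "HOL-Computational_Algebra.Computational_Algebra" "HOL-Library.Cardinality"
begin

(* Throughout, 'a is the finite field F_q with q = CARD('a), and 'a poly is A = F_q[T]. *)

abbreviation T :: "'a::finite_field poly" where
  "T \<equiv> [:0, 1:]"

lemma of_nat_binomial_card_eq_0:
  fixes i :: nat and ty :: "'a::finite_field itself"
  assumes "0 < i" "i < CARD('a)"
  shows "(of_nat (CARD('a) choose i) :: 'a) = 0"
proof -
  let ?q = "CARD('a)"
  define p :: "'a poly" where "p = (\<Sum>k\<in>{0<..<?q}. monom (of_nat (?q choose k)) k)"
  have q: "?q > 0" using assms by simp
  have ev: "poly p x = 0" for x :: 'a
  proof -
    have "(x + 1) ^ ?q = (\<Sum>k\<le>?q. of_nat (?q choose k) * x ^ k)"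
      by (subst binomial_ring) simp
    also have "{..?q} = insert 0 (insert ?q {0<..<?q})" using q by auto
    also have "(\<Sum>k\<in>\<dots>. of_nat (?q choose k) * x ^ k) = 1 + x ^ ?q + poly p x"
      using q by (simp add: p_def poly_sum poly_monom)
    finally show ?thesis by (simp add: finite_field_power_card_eq_same)
  qed
  have "degree p \<le> ?q - 1"
    unfolding p_def by (rule degree_sum_le) (auto intro: order.trans[OF degree_monom_le])
  then have deg: "degree p < ?q" using q by linarith
  have "p = 0"
  proof (rule ccontr)
    assume "p \<noteq> 0"
    then have "card {x. poly p x = 0} \<le> degree p" by (rule card_poly_roots_bound)
    then show False using ev deg by simp
  qed
  then have "coeff p i = 0" by simp
  then show ?thesis using assms by (simp add: p_def coeff_sum)
qed

lemma add_power_card: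
  fixes f g :: "'a::finite_field poly"
  shows "(f + g) ^ CARD('a) = f ^ CARD('a) + g ^ CARD('a)"
proof -
  let ?q = "CARD('a)"
  have q: "?q > 0" by simp
  have "{..?q} = insert 0 (insert ?q {0<..<?q})" using q by auto
  then have "(f + g) ^ ?q = g ^ ?q + f ^ ?q +
      (\<Sum>k\<in>{0<..<?q}. of_nat (?q choose k) * f ^ k * g ^ (?q - k))"
    using q by (simp add: binomial_ring add_ac)
  also have "(\<Sum>k\<in>{0<..<?q}. of_nat (?q choose k) * f ^ k * g ^ (?q - k)) = 0"
    by (rule sum.neutral) (auto simp: of_nat_poly of_nat_binomial_card_eq_0)
  finally show ?thesis by (simp add: add_ac)
qed

lemma add_power_card_power:
  fixes f g :: "'a::finite_field poly"
  shows "(f + g) ^ (CARD('a) ^ n) = f ^ (CARD('a) ^ n) + g ^ (CARD('a) ^ n)"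
  by (induction n) (simp_all add: power_mult mult.commute[of "CARD('a)"] add_power_card)

lemma mult_power_card_power:
  fixes f g :: "'a::finite_field poly"
  shows "(f * g ^ (CARD('a) ^ l)) ^ (CARD('a) ^ j) = f ^ (CARD('a) ^ j) * g ^ (CARD('a) ^ (j + l))"
proof -
  have "CARD('a) ^ (j + l) = CARD('a) ^ l * CARD('a) ^ j" by (simp add: power_add)
  then show ?thesis by (simp only: power_mult power_mult_distrib)
qed

lemma sum_power_card_power:
  fixes f :: "'b \<Rightarrow> 'a::finite_field poly"
  shows "sum f S ^ (CARD('a) ^ n) = (\<Sum>x\<in>S. f x ^ (CARD('a) ^ n))"
  by (induction S rule: infinite_finite_induct) (simp_all add: add_power_card_power)


(* The ring A<tau> of twisted polynomials, in which tau * c = c^q * tau for c in A.  It is the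
   subring of k<tau> with coefficients in A.  As T + tau lies in this subring, so does the whole
   image of the Carlitz module, and nothing changes by taking A<tau> as its codomain.
   The underlying element of 'a poly poly is the list of coefficients, written to the left
   of the powers of tau. *)

typedef (overloaded) 'a twisted_poly = "UNIV :: 'a::finite_field poly poly set"
  morphisms untwist Twist by simp

lemma untwist_Twist [simp]: "untwist (Twist f) = f"
  by (simp add: Twist_inverse)

definition tcoeff :: "'a::finite_field twisted_poly \<Rightarrow> nat \<Rightarrow> 'a poly" where
  "tcoeff f = coeff (untwist f)"

definition tdegree :: "'a::finite_field twisted_poly \<Rightarrow> nat" where
  "tdegree f = degree (untwist f)"

definition tconst :: "'a::finite_field poly \<Rightarrow> 'a twisted_poly" where
  "tconst c = Twist [:c:]"

definition tau :: "'a::finite_field twisted_poly" where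
  "tau = Twist (monom 1 1)"

definition twisted_mult :: "'a::finite_field poly poly \<Rightarrow> 'a poly poly \<Rightarrow> 'a poly poly" where
  "twisted_mult f g = (\<Sum>i\<le>degree f. \<Sum>j\<le>degree g.
     monom (coeff f i * coeff g j ^ (CARD('a) ^ i)) (i + j))"

lemma coeff_twisted_mult:
  fixes f g :: "'a::finite_field poly poly"
  shows "coeff (twisted_mult f g) n = (\<Sum>i\<le>n. coeff f i * coeff g (n - i) ^ (CARD('a) ^ i))"
proof -
  let ?h = "\<lambda>(i, j). coeff f i * coeff g j ^ (CARD('a) ^ i)"
  have "coeff (twisted_mult f g) n =
      (\<Sum>(i, j)\<in>{..degree f} \<times> {..degree g}. if i + j = n then ?h (i, j) else 0)"
    by (auto simp: twisted_mult_def coeff_sum sum.cartesian_product intro!: sum.cong)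
  also have "\<dots> = (\<Sum>(i, j)\<in>{(i, j). i + j = n}. ?h (i, j))"
  proof (rule sum.mono_neutral_cong)
    have "{(i, j). i + j = n} \<subseteq> {..n} \<times> {..n}" by auto
    then show "finite {(i, j). i + j = n}" by (rule finite_subset) simp
  qed (auto intro: le_degree)
  also have "\<dots> = (\<Sum>i\<le>n. ?h (i, n - i))"
    by (rule sum.reindex_bij_witness[of _ "\<lambda>i. (i, n - i)" fst]) auto
  finally show ?thesis by simp
qed

lemma twisted_mult_assoc:
  fixes f g h :: "'a::finite_field poly poly"
  shows "twisted_mult (twisted_mult f g) h = twisted_mult f (twisted_mult g h)"
proof (rule poly_eqI)
  fix n
  let ?q = "CARD('a)"
  have "coeff (twisted_mult (twisted_mult f g) h) n = (\<Sum>(i, j)\<in>Sigma {..n} (\<lambda>i. {..i}).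
     coeff f j * coeff g (i - j) ^ (?q ^ j) * coeff h (n - i) ^ (?q ^ i))"
    by (simp add: coeff_twisted_mult sum_distrib_right sum.Sigma)
  also have "\<dots> = (\<Sum>(j, l)\<in>Sigma {..n} (\<lambda>j. {..n - j}).
     coeff f j * coeff g l ^ (?q ^ j) * coeff h (n - (j + l)) ^ (?q ^ (j + l)))"
    by (rule sum.reindex_bij_witness[of _ "\<lambda>(j, l). (j + l, j)" "\<lambda>(i, j). (j, i - j)"]) auto
  also have "\<dots> = coeff (twisted_mult f (twisted_mult g h)) n"
    by (simp add: coeff_twisted_mult sum_distrib_left sum.Sigma sum_power_card_power
        mult_power_card_power mult.assoc)
  finally show "coeff (twisted_mult (twisted_mult f g) h) n =
    coeff (twisted_mult f (twisted_mult g h)) n" .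
qed

instantiation twisted_poly :: (finite_field) ring_1
begin

definition zero_twisted_poly :: "'a twisted_poly" where
  "0 = Twist 0"
definition one_twisted_poly :: "'a twisted_poly" where
  "1 = Twist 1"
definition plus_twisted_poly :: "'a twisted_poly \<Rightarrow> 'a twisted_poly \<Rightarrow> 'a twisted_poly" where
  "f + g = Twist (untwist f + untwist g)"
definition minus_twisted_poly :: "'a twisted_poly \<Rightarrow> 'a twisted_poly \<Rightarrow> 'a twisted_poly" where
  "f - g = Twist (untwist f - untwist g)"
definition uminus_twisted_poly :: "'a twisted_poly \<Rightarrow> 'a twisted_poly" where
  "- f = Twist (- untwist f)"
definition times_twisted_poly :: "'a twisted_poly \<Rightarrow> 'a twisted_poly \<Rightarrow> 'a twisted_poly" where
  "f * g = Twist (twisted_mult (untwist f) (untwist g))"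

lemmas twisted_defs = zero_twisted_poly_def one_twisted_poly_def plus_twisted_poly_def
  minus_twisted_poly_def uminus_twisted_poly_def times_twisted_poly_def

instance
proof
  fix a b c :: "'a twisted_poly"
  show "a * b * c = a * (b * c)" by (simp add: twisted_defs twisted_mult_assoc)
  have "twisted_mult 1 f = f" for f :: "'a poly poly"
  proof (rule poly_eqI)
    fix n
    have "coeff (twisted_mult 1 f) n = (\<Sum>i\<le>n. if i = 0 then coeff f n else 0)"
      unfolding coeff_twisted_mult by (rule sum.cong) (auto simp: coeff_1)
    then show "coeff (twisted_mult 1 f) n = coeff f n" by simp
  qed
  then show "1 * a = a" by (simp add: twisted_defs untwist_inverse)
  have "twisted_mult f 1 = f" for f :: "'a poly poly"
  proof (rule poly_eqI)
    fix n
    have "coeff (twisted_mult f 1) n = (\<Sum>i\<le>n. if i = n then coeff f i else 0)"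
      unfolding coeff_twisted_mult by (rule sum.cong) (auto simp: coeff_1)
    then show "coeff (twisted_mult f 1) n = coeff f n" by simp
  qed
  then show "a * 1 = a" by (simp add: twisted_defs untwist_inverse)
  show "a + b + c = a + (b + c)" by (simp add: twisted_defs add.assoc)
  show "a + b = b + a" by (simp add: twisted_defs add.commute)
  show "0 + a = a" by (simp add: twisted_defs untwist_inverse)
  show "- a + a = 0" by (simp add: twisted_defs)
  show "a - b = a + - b" by (simp add: twisted_defs)
  have "twisted_mult (f + g) h = twisted_mult f h + twisted_mult g h" for f g h :: "'a poly poly"
    by (simp add: poly_eq_iff coeff_twisted_mult algebra_simps sum.distrib)
  then show "(a + b) * c = a * c + b * c" by (simp add: twisted_defs)
  have "twisted_mult f (g + h) = twisted_mult f g + twisted_mult f h" for f g h :: "'a poly poly"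
    by (simp add: poly_eq_iff coeff_twisted_mult algebra_simps sum.distrib add_power_card_power)
  then show "a * (b + c) = a * b + a * c" by (simp add: twisted_defs)
  show "(0::'a twisted_poly) \<noteq> 1" by (simp add: twisted_defs Twist_inject)
qed

end

lemma tau_tconst: "tau * tconst c = tconst (c ^ CARD('a)) * tau"
  for c :: "'a::finite_field poly"
proof -
  have "twisted_mult (monom 1 1) [:c:] = twisted_mult [:c ^ CARD('a):] (monom 1 1)"
    by (simp add: twisted_mult_def degree_monom_eq atMost_Suc)
  then show ?thesis by (simp add: tau_def tconst_def twisted_defs)
qed

lemma tconst_add: "tconst (c + d) = tconst c + tconst d"
  by (simp add: tconst_def twisted_defs)

lemma tconst_mult: "tconst (c * d) = tconst c * tconst d"
  by (simp add: tconst_def twisted_defs twisted_mult_def monom_0)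

lemma tconst_0: "tconst 0 = 0"
  by (simp add: tconst_def twisted_defs)

lemma tconst_1: "tconst 1 = 1"
  by (simp add: tconst_def twisted_defs one_pCons)

lemma twisted_poly_expand: "f = (\<Sum>i\<le>tdegree f. tconst (tcoeff f i) * tau ^ i)"
proof -
  have mult_tau: "untwist (g * tau) = pCons 0 (untwist g)" for g :: "'a twisted_poly"
  proof (rule poly_eqI)
    fix n
    show "coeff (untwist (g * tau)) n = coeff (pCons 0 (untwist g)) n"
    proof (cases n)
      case (Suc m)
      have "coeff (twisted_mult (untwist g) (monom 1 1)) n =
          (\<Sum>i\<le>n. if i = m then coeff (untwist g) i else 0)"
        unfolding coeff_twisted_mult by (rule sum.cong) (auto simp: Suc)
      then show ?thesis by (simp add: Suc tau_def twisted_defs)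
    qed (simp add: coeff_twisted_mult tau_def twisted_defs)
  qed
  have m: "untwist (tconst c * tau ^ i) = monom c i" for c :: "'a poly" and i
    by (induction i)
      (simp_all add: power_Suc2 mult.assoc[symmetric] mult_tau tconst_def monom_0 monom_Suc
        del: power_Suc)
  have s: "untwist (sum g S) = (\<Sum>i\<in>S. untwist (g i))" for g :: "nat \<Rightarrow> 'a twisted_poly" and S
    by (induction S rule: infinite_finite_induct)
      (simp_all add: twisted_defs)
  have "untwist f = (\<Sum>i\<le>degree (untwist f). monom (coeff (untwist f) i) i)"
    by (simp add: poly_as_sum_of_monoms)
  also have "\<dots> = untwist (\<Sum>i\<le>tdegree f. tconst (tcoeff f i) * tau ^ i)"
    by (simp add: s m tcoeff_def tdegree_def)
  finally show ?thesis by (simp add: untwist_inject)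
qed

(* tau acts on A as x |-> x^q *)
definition teval :: "'a::finite_field twisted_poly \<Rightarrow> 'a poly \<Rightarrow> 'a poly" where
  "teval f x = (\<Sum>i\<le>tdegree f. tcoeff f i * x ^ (CARD('a) ^ i))"

lemma teval_mult:
  fixes f g :: "'a::finite_field twisted_poly"
  shows "teval (f * g) x = teval f (teval g x)"
proof -
  let ?q = "CARD('a)"
  define N where "N = max (tdegree (f * g)) (tdegree f + tdegree g)"
  have z: "tcoeff h i = 0" if "tdegree h < i" for h :: "'a twisted_poly" and i
    using that by (simp add: tcoeff_def tdegree_def coeff_eq_0)
  have c: "tcoeff (f * g) n = (\<Sum>i\<le>n. tcoeff f i * tcoeff g (n - i) ^ (?q ^ i))" for n
    by (simp add: tcoeff_def times_twisted_poly_def coeff_twisted_mult)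
  have "teval (f * g) x = (\<Sum>n\<le>N. tcoeff (f * g) n * x ^ (?q ^ n))"
    unfolding teval_def by (rule sum.mono_neutral_left) (auto simp: N_def z)
  also have "\<dots> = (\<Sum>(n, i)\<in>Sigma {..N} (\<lambda>n. {..n}).
      tcoeff f i * tcoeff g (n - i) ^ (?q ^ i) * x ^ (?q ^ n))"
    by (simp add: c sum_distrib_right sum.Sigma)
  also have "\<dots> = (\<Sum>(i, j)\<in>Sigma {..N} (\<lambda>i. {..N - i}).
      tcoeff f i * tcoeff g j ^ (?q ^ i) * x ^ (?q ^ (i + j)))"
    by (rule sum.reindex_bij_witness[of _ "\<lambda>(i, j). (i + j, i)" "\<lambda>(n, i). (i, n - i)"]) auto
  also have "\<dots> = (\<Sum>(i, j)\<in>{..tdegree f} \<times> {..tdegree g}.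
      tcoeff f i * tcoeff g j ^ (?q ^ i) * x ^ (?q ^ (i + j)))"
  proof (rule sum.mono_neutral_right)
    show "\<forall>p\<in>Sigma {..N} (\<lambda>i. {..N - i}) - {..tdegree f} \<times> {..tdegree g}.
      (case p of (i, j) \<Rightarrow> tcoeff f i * tcoeff g j ^ (?q ^ i) * x ^ (?q ^ (i + j))) = 0"
      by (auto intro: ccontr simp: z not_le)
  qed (auto simp: N_def)
  also have "\<dots> = teval f (teval g x)"
    by (simp add: teval_def sum_power_card_power sum.cartesian_product[symmetric] sum_distrib_left
        mult_power_card_power mult.assoc)
  finally show ?thesis .
qed


definition carlitz :: "'a::finite_field poly \<Rightarrow> 'a twisted_poly" where
  "carlitz a = (\<Sum>i\<le>degree a. tconst [:coeff a i:] * (tconst T + tau) ^ i)"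

lemma carlitz_pCons: "carlitz (pCons c a) = tconst [:c:] + carlitz a * (tconst T + tau)"
proof (cases "a = 0")
  case False
  then show ?thesis
    unfolding carlitz_def degree_pCons_eq[OF False] sum.atMost_Suc_shift sum_distrib_right
    by (simp add: power_Suc2 mult.assoc del: power_Suc)
qed (simp add: carlitz_def tconst_0)

lemma carlitz_const: "carlitz [:c:] = tconst [:c:]"
  by (simp add: carlitz_def)

lemma carlitz_1: "carlitz 1 = 1"
  by (simp add: one_pCons carlitz_const tconst_1[unfolded one_pCons])

lemma carlitz_T: "carlitz T = tconst T + tau"
  by (simp add: carlitz_def tconst_0 tconst_1[unfolded one_pCons])

lemma carlitz_add: "carlitz (a + b) = carlitz a + carlitz b"
proof (induction a b rule: poly_induct2)
  case (pCons c a d b)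
  have "tconst [:c + d:] = tconst [:c:] + tconst [:d:]" by (simp flip: tconst_add)
  then show ?case by (simp add: pCons carlitz_pCons algebra_simps)
qed (simp add: carlitz_def tconst_0)

(* the F_q-algebra structure is well defined: constants are central *)
lemma tconst_commute:
  fixes f :: "'a::finite_field twisted_poly"
  shows "tconst [:c:] * f = f * tconst [:c:]"
proof -
  have "[:c:] ^ (CARD('a) ^ n) = [:c:]" for n
  proof (induction n)
    case (Suc n)
    have "[:c:] ^ (CARD('a) ^ Suc n) = ([:c:] ^ CARD('a)) ^ (CARD('a) ^ n)"
      by (simp add: power_mult)
    also have "[:c:] ^ CARD('a) = [:c ^ CARD('a):]" by (simp add: poly_const_pow)
    finally show ?case using Suc by (simp add: finite_field_power_card_eq_same)
  qed simp
  then show ?thesis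
    by (simp add: tconst_def times_twisted_poly_def twisted_mult_def mult.commute)
qed

lemma carlitz_mult: "carlitz (a * b) = carlitz a * carlitz b"
proof (induction a)
  case 0
  then show ?case by (simp add: carlitz_def tconst_0)
next
  case (pCons c a)
  have smult: "carlitz (smult c b) = tconst [:c:] * carlitz b"
  proof (induction b)
    case (pCons d b)
    have "tconst [:c * d:] = tconst [:c:] * tconst [:d:]"
      by (simp add: mult.commute flip: tconst_mult)
    then show ?case by (simp add: carlitz_pCons pCons algebra_simps)
  qed (simp add: carlitz_def tconst_0)
  have comm: "carlitz b * (tconst T + tau) = (tconst T + tau) * carlitz b"
  proof (induction b)
    case (pCons d b)
    then show ?case
      by (simp only: carlitz_pCons distrib_left[of "tconst T + tau"] distrib_right[of _ _ "tconst T + tau"]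
          tconst_commute mult.assoc)
  qed (simp add: carlitz_def tconst_0)
  show ?case
    by (simp add: carlitz_pCons carlitz_add smult pCons tconst_0 comm distrib_right mult.assoc
        del: mult_pCons_right)
qed

lemma carlitz_unique:
  assumes "\<And>a b. h (a + b) = h a + h b" and "\<And>a b. h (a * b) = h a * h b"
    and "\<And>c. h [:c:] = tconst [:c:]" and "h T = tconst T + tau"
  shows "h a = carlitz a"
proof (induction a)
  case 0
  then show ?case by (metis assms(3) carlitz_const pCons_0_0)
next
  case (pCons c a)
  have "pCons c a = [:c:] + a * T" by simp
  then show ?case by (metis assms carlitz_pCons pCons.IH)
qed

(* C_a(x) for x in A *)
definition carlitz_eval :: "'a::finite_field poly \<Rightarrow> 'a poly \<Rightarrow> 'a poly" where
  "carlitz_eval a x = teval (carlitz a) x"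

lemma carlitz_eval_T: "carlitz_eval T x = T * x + x ^ CARD('a)"
  for x :: "'a::finite_field poly"
proof -
  have "untwist (tconst T + tau :: 'a twisted_poly) = [:T, 1:]"
    by (simp add: plus_twisted_poly_def tconst_def tau_def monom_altdef)
  then show ?thesis
    by (simp add: carlitz_eval_def carlitz_T teval_def tdegree_def tcoeff_def)
qed

lemma carlitz_eval_mult: "carlitz_eval (a * b) x = carlitz_eval a (carlitz_eval b x)"
  by (simp add: carlitz_eval_def carlitz_mult teval_mult)


definition monic_prime :: "'a::finite_field poly \<Rightarrow> bool" where
  "monic_prime P \<longleftrightarrow> prime_elem P \<and> lead_coeff P = 1"

(* Both notions below are meant for nonzero u and m; P is the prime. *)

definition zsigmondy_prime :: "'a::finite_field poly \<Rightarrow> 'a poly \<Rightarrow> 'a poly \<Rightarrow> bool" where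
  "zsigmondy_prime u m P \<longleftrightarrow> monic_prime P \<and> P dvd carlitz_eval m u \<and>
     (\<forall>n. n \<noteq> 0 \<and> degree n < degree m \<longrightarrow> \<not> P dvd carlitz_eval n u)"

definition large_zsigmondy_prime :: "'a::finite_field poly \<Rightarrow> 'a poly \<Rightarrow> 'a poly \<Rightarrow> bool" where
  "large_zsigmondy_prime u m P \<longleftrightarrow> zsigmondy_prime u m P \<and>
     (degree P > degree m \<or> P ^ 2 dvd carlitz_eval m u)"

end

theory Submission
  imports Defs Complex_Main
begin

text \<open>
  Let \<open>P\<close> be a monic prime. The order of \<open>u\<close> modulo \<open>P\<close>, the monic generator of
  \<open>{n. C\<^sub>n(u) \<equiv> 0 (mod P)}\<close>, divides \<open>P - 1\<close>, because \<open>C\<^sub>P \<equiv> \<tau>\<^bsup>deg P\<^esup> (mod P)\<close>. So a Zsigmondy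
  prime for \<open>(u, m)\<close>, being a prime modulo which \<open>u\<close> has order \<open>m\<close>, is \<open>1\<close> modulo \<open>m\<close>, and
  only \<open>m + 1\<close> can fail to be large. Hence a large Zsigmondy prime exists if and only if the part of
  \<open>C\<^sub>m(u)\<close> composed of Zsigmondy primes has degree greater than \<open>deg m\<close>.

  For \<open>q > 2\<close> the exponent of \<open>P\<close> in \<open>C\<^bsub>nk\<^esub>(u)\<close>, with \<open>n\<close> the order of \<open>u\<close>, exceeds that in
  \<open>C\<^sub>n(u)\<close> by exactly the exponent of \<open>P\<close> in \<open>k\<close>. Moebius inversion over the divisors of \<open>m\<close>
  then shows that the degree in question is \<open>deg u \<cdot> \<phi>(m)\<close> for nonconstant \<open>u\<close>, and
  \<open>(\<phi>(m) - \<mu>(m)) / q\<close> for \<open>u = 1\<close>, minus the degrees of the few primes \<open>P\<close> for which \<open>m\<close> is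
  a proper multiple of the order of \<open>u\<close> by a power of \<open>P\<close>. Comparing with \<open>deg m\<close> leaves only
  small cases.
\<close>

section \<open>Arithmetic of the Carlitz module\<close>

text \<open>The special primes are distinct prime divisors of \<open>m\<close>, so together they
  cost at most \<open>degree m\<close>, while \<open>\<phi>(m)\<close> is at least
  \<open>(q - 1) ^ degree m\<close>. Hence it suffices to beat \<open>2 * degree m\<close>, an
  exponential against a linear bound. The term \<open>\<mu>(m)\<close> comes from constant
  \<open>n\<close>: the degree of \<open>C_n(1)\<close> is \<open>q ^ (degree n - 1)\<close> for
  nonconstant \<open>n\<close>, but 0 instead of \<open>1 / q\<close> for constant \<open>n\<close>.
  For \<open>u = 1\<close> the division by \<open>q\<close> weakens the bound, so for
  \<open>q = 3\<close> the few linear primes have to be counted. Residue rings modulo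
  \<open>P\<close> are never formed; facts about them are phrased as divisibility by
  \<open>P\<close>, and the analogue of Fermat's theorem comes from \<open>C_a\<close> commuting
  with \<open>C_T\<close>.\<close>

abbreviation tc :: "'a::finite_field poly \<Rightarrow> nat \<Rightarrow> 'a poly" where
  "tc a \<equiv> tcoeff (carlitz a)"

lemma tcoeff_eq_0: "tdegree h < i \<Longrightarrow> tcoeff h i = 0"
  by (simp add: tcoeff_def tdegree_def coeff_eq_0)

lemma teval_altdef:
  fixes f :: "'a::finite_field twisted_poly"
  assumes "tdegree f \<le> N"
  shows "teval f x = (\<Sum>i\<le>N. tcoeff f i * x ^ (CARD('a) ^ i))"
  unfolding teval_def by (rule sum.mono_neutral_left) (use assms in \<open>auto simp: tcoeff_eq_0\<close>)

lemma tcoeff_add: "tcoeff (f + g) i = tcoeff f i + tcoeff g i"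
  by (simp add: tcoeff_def plus_twisted_poly_def)

lemma teval_add: "teval (f + g) x = teval f x + teval g x"
  for f g :: "'a::finite_field twisted_poly"
proof -
  define N where "N = max (tdegree (f + g)) (max (tdegree f) (tdegree g))"
  show ?thesis
    by (subst (1 2 3) teval_altdef[where N = N])
      (simp_all add: N_def tcoeff_add algebra_simps sum.distrib)
qed

lemma teval_tconst: "teval (tconst c) x = c * x" for c :: "'a::finite_field poly"
  by (simp add: teval_def tdegree_def tcoeff_def tconst_def)

lemma carlitz_eval_add: "carlitz_eval (a + b) x = carlitz_eval a x + carlitz_eval b x"
  by (simp add: carlitz_eval_def carlitz_add teval_add)

lemma carlitz_eval_const: "carlitz_eval [:c:] x = smult c x"
  by (simp add: carlitz_eval_def carlitz_const teval_tconst)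

lemma carlitz_eval_0 [simp]: "carlitz_eval 0 x = 0"
  using carlitz_eval_const[of 0 x] by simp

lemma carlitz_eval_1 [simp]: "carlitz_eval 1 x = x"
  using carlitz_eval_const[of 1 x] by (simp add: one_pCons)

lemma carlitz_eval_minus: "carlitz_eval (- a) x = - carlitz_eval a x"
  using carlitz_eval_add[of a "- a" x] by (simp add: eq_neg_iff_add_eq_0 add.commute)

lemma carlitz_eval_diff: "carlitz_eval (a - b) x = carlitz_eval a x - carlitz_eval b x"
  using carlitz_eval_add[of a "- b" x] by (simp add: carlitz_eval_minus)

lemma carlitz_eval_pCons:
  "carlitz_eval (pCons c a) x = smult c x + T * carlitz_eval a x + carlitz_eval a x ^ CARD('a)"
  for x :: "'a::finite_field poly"
proof -
  have "pCons c a = [:c:] + T * a" by simp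
  then show ?thesis
    by (simp only: carlitz_eval_add carlitz_eval_mult carlitz_eval_const carlitz_eval_T add.assoc)
qed

lemma dvd_carlitz_eval_self: "x dvd carlitz_eval a x" for x :: "'a::finite_field poly"
proof (induction a)
  case (pCons c a)
  then have "x dvd carlitz_eval a x ^ CARD('a)" by (simp add: dvd_power_same dvd_trans[OF _ dvd_power])
  with pCons show ?case
    unfolding carlitz_eval_pCons by (intro dvd_add dvd_mult dvd_smult) auto
qed simp

lemma dvd_carlitz_eval: "b dvd a \<Longrightarrow> carlitz_eval b x dvd carlitz_eval a x"
  by (auto simp: mult.commute[of b] carlitz_eval_mult dvd_carlitz_eval_self)

text \<open>Each step of the recursion adds only the \<open>q\<close>-th power of a multiple of
  \<open>x\<close>. This is all that the lifting of exponents uses about the nonlinear terms of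
  \<open>C_a\<close>.\<close>

lemma carlitz_eval_linear_part: "x ^ CARD('a) dvd carlitz_eval a x - a * x"
  for x :: "'a::finite_field poly"
proof (induction a)
  case (pCons c a)
  have "carlitz_eval (pCons c a) x - pCons c a * x
    = T * (carlitz_eval a x - a * x) + carlitz_eval a x ^ CARD('a)"
    by (simp add: carlitz_eval_pCons algebra_simps)
  moreover have "x ^ CARD('a) dvd carlitz_eval a x ^ CARD('a)"
    by (intro dvd_power_same dvd_carlitz_eval_self)
  ultimately show ?case using pCons by (simp del: mult_pCons_left)
qed simp

section \<open>Coefficients of the Carlitz module\<close>

lemma tcoeff_mult:
  fixes f g :: "'a::finite_field twisted_poly"
  shows "tcoeff (f * g) n = (\<Sum>i\<le>n. tcoeff f i * tcoeff g (n - i) ^ (CARD('a) ^ i))"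
  by (simp add: tcoeff_def times_twisted_poly_def coeff_twisted_mult)

lemma tcoeff_tconst: "tcoeff (tconst c) n = (if n = 0 then c else 0)"
  by (simp add: tcoeff_def tconst_def coeff_pCons split: nat.split)

lemma tcoeff_T_tau: "tcoeff (tconst T + tau) n = (if n = 0 then T else if n = 1 then 1 else 0)"
  by (simp add: tcoeff_add tcoeff_tconst) (simp add: tcoeff_def tau_def)

lemma tcoeff_mult_T_tau:
  fixes f :: "'a::finite_field twisted_poly"
  shows "tcoeff (f * (tconst T + tau)) (Suc n) =
    tcoeff f (Suc n) * T ^ (CARD('a) ^ Suc n) + tcoeff f n"
proof -
  have "tcoeff (f * (tconst T + tau)) (Suc n) = (\<Sum>i\<in>{n, Suc n}. tcoeff f i *
    tcoeff (tconst T + tau) (Suc n - i) ^ (CARD('a) ^ i))"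
    unfolding tcoeff_mult
    by (rule sum.mono_neutral_right) (auto simp: tcoeff_T_tau power_0_left)
  then show ?thesis by (simp add: tcoeff_T_tau)
qed

lemma tcoeff_T_tau_mult:
  fixes f :: "'a::finite_field twisted_poly"
  shows "tcoeff ((tconst T + tau) * f) (Suc n) = T * tcoeff f (Suc n) + tcoeff f n ^ CARD('a)"
proof -
  have "tcoeff ((tconst T + tau) * f) (Suc n) = (\<Sum>i\<in>{0, 1}. tcoeff (tconst T + tau) i *
    tcoeff f (Suc n - i) ^ (CARD('a) ^ i))"
    unfolding tcoeff_mult
    by (rule sum.mono_neutral_right) (auto simp: tcoeff_T_tau)
  then show ?thesis by (simp add: tcoeff_T_tau)
qed

text \<open>\<open>C_a\<close> commutes with \<open>C_T = T + tau\<close>; the two sides arise by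
  comparing coefficients of \<open>tau ^ (n + 1)\<close>. Modulo a prime this controls each
  coefficient by the previous one as long as \<open>T ^ (q ^ (n + 1)) - T\<close> is
  invertible.\<close>

lemma tcoeff_carlitz_rec:
  "tc a (Suc n) * (T ^ (CARD('a) ^ Suc n) - T) = tc a n ^ CARD('a) - tc a n"
  for a :: "'a::finite_field poly"
proof -
  have "carlitz a * (tconst T + tau) = (tconst T + tau) * carlitz a"
    unfolding carlitz_T[symmetric] carlitz_mult[symmetric] by (simp only: mult.commute)
  from arg_cong[OF this, of "\<lambda>f. tcoeff f (Suc n)"]
  show ?thesis unfolding tcoeff_mult_T_tau tcoeff_T_tau_mult by (simp add: algebra_simps)
qed

lemma tcoeff_carlitz_0: "tc a 0 = a" for a :: "'a::finite_field poly"
proof (induction a)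
  case (pCons c a)
  have "tcoeff (carlitz a * (tconst T + tau)) 0 = a * T"
    using pCons by (simp add: tcoeff_mult tcoeff_T_tau)
  then show ?case by (simp add: carlitz_pCons tcoeff_add tcoeff_tconst)
qed (simp add: carlitz_const[of 0, simplified] tcoeff_tconst)

lemma tcoeff_carlitz_degree:
  fixes a :: "'a::finite_field poly"
  shows "(\<forall>i>degree a. tc a i = 0) \<and> tc a (degree a) = [:lead_coeff a:]"
proof (induction a)
  case (pCons c a)
  have *: "tc (pCons c a) (Suc n) = tc a (Suc n) * T ^ (CARD('a) ^ Suc n) + tc a n" for n
    by (simp only: carlitz_pCons tcoeff_add tcoeff_mult_T_tau tcoeff_tconst) simp
  show ?case
  proof (cases "a = 0")
    case True
    then show ?thesis
      by (simp add: carlitz_const tcoeff_tconst)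
  next
    case False
    show ?thesis
    proof (intro conjI allI impI)
      fix i assume i: "i > degree (pCons c a)"
      then obtain j where "i = Suc j" by (cases i) auto
      then show "tc (pCons c a) i = 0" using i False pCons by (simp only: *) simp
    qed (use False pCons * in simp)
  qed
qed (simp add: carlitz_const[of 0, simplified] tcoeff_tconst)

lemma carlitz_eval_altdef:
  fixes a x :: "'a::finite_field poly"
  shows "carlitz_eval a x = (\<Sum>i\<le>degree a. tc a i * x ^ (CARD('a) ^ i))"
proof -
  have "carlitz_eval a x = (\<Sum>i\<le>max (degree a) (tdegree (carlitz a)). tc a i * x ^ (CARD('a) ^ i))"
    unfolding carlitz_eval_def by (rule teval_altdef) simp
  also have "\<dots> = (\<Sum>i\<le>degree a. tc a i * x ^ (CARD('a) ^ i))"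
    by (rule sum.mono_neutral_right) (use tcoeff_carlitz_degree[of a] in auto)
  finally show ?thesis .
qed

section \<open>Reduction modulo a prime\<close>

text \<open>Over a domain, a polynomial with more roots than its degree vanishes. Applied to the
  quotient by \<open>P\<close>, this becomes a statement about pairwise incongruent elements of
  \<open>A\<close>; the induction splits off one of them by synthetic division over the original
  ring.\<close>

lemma prime_elem_roots_bound:
  fixes f :: "'b::idom poly"
  assumes P: "prime_elem P"
    and "finite A" and "\<And>a. a \<in> A \<Longrightarrow> P dvd poly f a"
    and "\<And>a b. a \<in> A \<Longrightarrow> b \<in> A \<Longrightarrow> P dvd a - b \<Longrightarrow> a = b"
    and "card A > degree f"
  shows "P dvd coeff f i"
  using assms(2-)
proof (induction "degree f" arbitrary: f A i)
  case 0
  then obtain a where "a \<in> A" by fastforce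
  moreover obtain c where "f = [:c:]" using 0 by (metis degree_eq_zeroE)
  ultimately show ?case using 0 by (auto simp: coeff_pCons split: nat.split)
next
  case (Suc n)
  then obtain a where a: "a \<in> A" by fastforce
  define g where "g = synthetic_div f a"
  have f: "f = [:-a, 1:] * g + [:poly f a:]"
    using synthetic_div_correct'[of a f] by (simp add: g_def)
  have dg: "degree g = n" using Suc by (simp add: g_def degree_synthetic_div)
  have "P dvd coeff g j" for j
  proof (rule Suc.hyps(1)[of g "A - {a}"])
    fix b assume b: "b \<in> A - {a}"
    have "poly f b = (b - a) * poly g b + poly f a"
      by (subst f) (simp add: algebra_simps)
    then have "P dvd (b - a) * poly g b"
      using Suc.prems(2)[of a] Suc.prems(2)[of b] a b by (metis DiffD1 dvd_add_left_iff)
    then show "P dvd poly g b" using b Suc.prems(3)[of b a] a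
      by (auto simp: prime_elem_dvd_mult_iff[OF P])
  qed (use Suc dg a in auto)
  then have "P dvd coeff ([:-a, 1:] * g) j" for j
    by (cases j) (auto simp: coeff_pCons dvd_diff)
  moreover have "P dvd coeff [:poly f a:] j" for j
    using Suc.prems(2)[OF a] by (cases j) auto
  ultimately show ?case by (subst f) (simp only: coeff_add dvd_add)
qed

lemma monic_prime_degree_pos: "monic_prime P \<Longrightarrow> degree P > 0"
  by (auto simp: monic_prime_def prime_elem_def is_unit_iff_degree intro!: gr0I)

lemma finite_degree_less: "finite {a :: 'a::{finite,zero} poly. degree a < n}"
  and card_degree_less: "n > 0 \<Longrightarrow> card {a :: 'a poly. degree a < n} = CARD('a) ^ n"
proof -
  let ?L = "{xs :: 'a list. length xs = n}" and ?A = "{a :: 'a poly. degree a < n}"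
  have L: "finite ?L" "card ?L = CARD('a) ^ n"
    using finite_lists_length_eq[of "UNIV :: 'a set" n] card_lists_length_eq[of "UNIV :: 'a set" n]
    by simp_all
  have inj: "inj_on Poly ?L"
  proof (rule inj_onI)
    fix xs ys :: "'a list" assume *: "xs \<in> ?L" "ys \<in> ?L" "Poly xs = Poly ys"
    then have "nth_default 0 xs i = nth_default 0 ys i" for i by (metis coeff_Poly_eq)
    with * show "xs = ys"
      by (intro nth_equalityI) (auto simp: nth_default_def split: if_splits dest: meta_spec)
  qed
  have sub: "?A \<subseteq> Poly ` ?L"
  proof
    fix a :: "'a poly" assume "a \<in> ?A"
    then have "a = Poly (map (coeff a) [0..<n])"
      by (intro poly_eqI) (auto simp: nth_default_def coeff_eq_0)
    then show "a \<in> Poly ` ?L" by (rule image_eqI) simp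
  qed
  show "finite ?A" by (rule finite_subset[OF sub]) (simp add: L)
  assume n: "n > 0"
  have "Poly ` ?L \<subseteq> ?A"
  proof
    fix a :: "'a poly" assume "a \<in> Poly ` ?L"
    then obtain xs :: "'a list" where "a = Poly xs" "length xs = n" by auto
    then have "degree a \<le> n - 1" by (intro degree_le) (auto simp: nth_default_def)
    then show "a \<in> ?A" using n by simp
  qed
  with sub have "?A = Poly ` ?L" by blast
  then show "card ?A = CARD('a) ^ n" by (simp add: card_image inj L)
qed

lemma pCons_power_card_power:
  "(pCons c a) ^ (CARD('a) ^ n) = [:c:] + T ^ (CARD('a) ^ n) * a ^ (CARD('a) ^ n)"
  for a :: "'a::finite_field poly"
proof -
  have "pCons c a = [:c:] + T * a" by simp
  then show ?thesis
    by (simp only: add_power_card_power power_mult_distrib)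
      (simp add: poly_const_pow finite_field_power_card_power_eq_same)
qed

lemma dvd_power_card_minus_self:
  fixes a :: "'a::finite_field poly"
  assumes "P dvd T ^ (CARD('a) ^ n) - T"
  shows "P dvd a ^ (CARD('a) ^ n) - a"
proof (induction a)
  case (pCons c a)
  let ?Q = "CARD('a) ^ n"
  have "pCons c a ^ ?Q - pCons c a = T ^ ?Q * a ^ ?Q - T * a"
    by (subst pCons_power_card_power) (simp add: algebra_simps)
  also have "\<dots> = (T ^ ?Q - T) * a ^ ?Q + T * (a ^ ?Q - a)"
    by (simp only: algebra_simps)
  finally show ?case using assms pCons by (simp only: dvd_add dvd_mult dvd_mult2)
qed (simp add: power_0_left)

lemma card_finite_field_ge_2: "2 \<le> CARD('a::finite_field)"
  using card_mono[of "UNIV :: 'a set" "{0, 1}"] by simp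

text \<open>Otherwise every polynomial would satisfy \<open>a ^ (q ^ n) = a\<close> modulo
  \<open>P\<close>, giving \<open>q ^ degree P\<close> incongruent roots to an equation of degree
  \<open>q ^ n\<close>.\<close>

lemma not_dvd_T_power_card:
  fixes P :: "'a::finite_field poly"
  assumes P: "monic_prime P" and n: "0 < n" "n < degree P"
  shows "\<not> P dvd T ^ (CARD('a) ^ n) - T"
proof
  assume *: "P dvd T ^ (CARD('a) ^ n) - T"
  let ?Q = "CARD('a) ^ n"
  have q: "1 < CARD('a)" using card_finite_field_ge_2[where 'a = 'a] by simp
  have Q: "?Q > 1" using q n(1) by (rule one_less_power)
  define f :: "'a poly poly" where "f = monom 1 ?Q - monom 1 1"
  have deg: "degree f \<le> ?Q"
    unfolding f_def by (intro degree_diff_le degree_monom_le order.trans[OF degree_monom_le]) (use Q in auto)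
  have "P dvd coeff f ?Q"
  proof (rule prime_elem_roots_bound)
    show "prime_elem P" using P by (simp add: monic_prime_def)
    let ?A = "{a :: 'a poly. degree a < degree P}"
    show "finite ?A" by (rule finite_degree_less)
    show "P dvd poly f a" for a
      using dvd_power_card_minus_self[OF *] by (simp add: f_def poly_monom)
    show "a = b" if "a \<in> ?A" "b \<in> ?A" "P dvd a - b" for a b
      using that degree_diff_less[of a "degree P" b] dvd_imp_degree_le[of P "a - b"] by fastforce
    have "?Q < CARD('a) ^ degree P" using q n by (intro power_strict_increasing) auto
    then show "degree f < card ?A" using n deg by (simp add: card_degree_less)
  qed
  then have "is_unit P" using Q by (simp add: f_def)
  then show False using P by (simp add: monic_prime_def prime_elem_not_unit)
qed

lemma dvd_power_diff: "P dvd a \<Longrightarrow> n > 0 \<Longrightarrow> P dvd a ^ n - (a::'a::comm_ring_1)"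
  by (simp add: dvd_power dvd_trans[OF _ dvd_power] dvd_diff)

text \<open>The coefficient of index 0 is \<open>P\<close> itself, and the recursion passes
  divisibility upwards because \<open>T ^ (q ^ i) - T\<close> is prime to \<open>P\<close> for
  \<open>0 < i < degree P\<close>.\<close>

lemma prime_dvd_tcoeff_carlitz:
  fixes P :: "'a::finite_field poly"
  assumes P: "monic_prime P"
  shows "i < degree P \<Longrightarrow> P dvd tc P i"
proof (induction i)
  case 0
  then show ?case by (simp add: tcoeff_carlitz_0)
next
  case (Suc i)
  then have "P dvd tc P (Suc i) * (T ^ (CARD('a) ^ Suc i) - T)"
    unfolding tcoeff_carlitz_rec by (intro dvd_power_diff) auto
  then show ?case using not_dvd_T_power_card[OF P, of "Suc i"] Suc.prems P
    by (auto simp: prime_elem_dvd_mult_iff monic_prime_def)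
qed

text \<open>Modulo \<open>P\<close> only the leading term of \<open>C_P\<close> survives, so
  \<open>C_P(u)\<close> becomes \<open>u ^ (q ^ degree P)\<close>, which is again
  \<open>u\<close>.\<close>

lemma prime_dvd_carlitz_eval_minus_1:
  fixes P u :: "'a::finite_field poly"
  assumes P: "monic_prime P"
  shows "P dvd carlitz_eval (P - 1) u"
proof -
  let ?D = "degree P"
  have D: "?D > 0" using monic_prime_degree_pos[OF P] .
  then obtain k where k: "?D = Suc k" using gr0_implies_Suc by blast
  have lc: "tc P ?D = 1" using P tcoeff_carlitz_degree[of P] by (simp add: monic_prime_def one_pCons)
  \<comment> \<open>At the top index, where the coefficient is 1, the recursion itself yields
    Fermat's congruence for \<open>T\<close>.\<close>
  have "P dvd tc P k ^ CARD('a) - tc P k"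
    by (intro dvd_power_diff prime_dvd_tcoeff_carlitz[OF P]) (use k in auto)
  then have "P dvd T ^ (CARD('a) ^ ?D) - T"
    unfolding tcoeff_carlitz_rec[symmetric] k[symmetric] lc by simp
  then have 1: "P dvd u ^ (CARD('a) ^ ?D) - u" by (rule dvd_power_card_minus_self)
  have "carlitz_eval P u = (\<Sum>i<?D. tc P i * u ^ (CARD('a) ^ i)) + u ^ (CARD('a) ^ ?D)"
    unfolding carlitz_eval_altdef by (simp add: lc lessThan_Suc_atMost[symmetric])
  moreover have "P dvd (\<Sum>i<?D. tc P i * u ^ (CARD('a) ^ i))"
    by (intro dvd_sum dvd_mult2 prime_dvd_tcoeff_carlitz[OF P]) auto
  ultimately show ?thesis using 1
    using dvd_add[of P _ "u ^ (CARD('a) ^ ?D) - u"]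
    by (simp add: carlitz_eval_diff add_diff_eq)
qed

section \<open>Valuations at monic primes\<close>

lemma monic_primeD: "monic_prime P \<Longrightarrow> prime_elem P" "monic_prime P \<Longrightarrow> P \<noteq> 0"
  "monic_prime P \<Longrightarrow> \<not> P dvd 1" "monic_prime P \<Longrightarrow> lead_coeff P = 1"
  by (auto simp: monic_prime_def prime_elem_def)

lemma monic_dvd_antisym:
  assumes "lead_coeff P = 1" "lead_coeff R = (1 :: 'a::field)" "P dvd R" "degree R \<le> degree P"
  shows "P = R"
proof -
  obtain c where c: "R = P * c" using assms by auto
  with assms have "c \<noteq> 0" "P \<noteq> 0" by auto
  with c assms have "degree c = 0" by (simp add: degree_mult_eq)
  then obtain d where "c = [:d:]" by (metis degree_eq_zeroE)
  with c assms show ?thesis by (auto simp: one_pCons[symmetric] split: if_splits)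
qed

lemma monic_prime_dvd_iff_eq:
  assumes "monic_prime P" "monic_prime R"
  shows "P dvd R \<longleftrightarrow> P = R"
proof
  assume "P dvd R"
  then obtain c where c: "R = P * c" by auto
  then have "R dvd P \<or> R dvd c"
    using assms(2) prime_elem_dvd_mult_iff[of R P c] by (simp add: monic_primeD)
  moreover have "\<not> R dvd c"
  proof
    assume "R dvd c"
    then obtain k where "c = R * k" by auto
    then have "R * (P * k) = R * 1" using c by (simp add: mult.left_commute)
    then have "P * k = 1" using monic_primeD(2)[OF assms(2)] by (simp only: mult_cancel_left) simp
    then show False using monic_primeD(3)[OF assms(1)] by (metis dvd_triv_left)
  qed
  ultimately have "degree R \<le> degree P" using assms by (simp add: dvd_imp_degree_le monic_primeD)
  then show "P = R" using \<open>P dvd R\<close> assms by (intro monic_dvd_antisym) (auto simp: monic_primeD)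
qed simp

lemma monic_prime_divisor_exists:
  fixes x :: "'a::finite_field poly"
  assumes "degree x > 0"
  shows "\<exists>P. monic_prime P \<and> P dvd x"
  using assms
proof (induction "degree x" arbitrary: x rule: less_induct)
  case less
  show ?case
  proof (cases "irreducible x")
    case True
    define c where "c = inverse (lead_coeff x)"
    have "x \<noteq> 0" using less by auto
    then have "prime_elem (smult c x)" "lead_coeff (smult c x) = 1" "smult c x dvd x"
      using True field_poly_irreducible_imp_prime[OF True]
      by (auto simp: c_def smult_dvd_iff prime_elem_def dvd_smult_iff)
    then show ?thesis unfolding monic_prime_def by blast
  next
    case False
    have "x \<noteq> 0" using less.prems by auto
    then have x: "x \<noteq> 0" "\<not> is_unit x" using less.prems by (auto simp: is_unit_iff_degree)
    with False obtain a b where ab: "x = a * b" "\<not> is_unit a" "\<not> is_unit b"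
      unfolding irreducible_def by blast
    with x have "a \<noteq> 0" "b \<noteq> 0" by auto
    with ab have "degree a > 0" "degree b > 0" "degree x = degree a + degree b"
      by (auto simp: degree_mult_eq is_unit_iff_degree)
    with less(1)[of a] ab show ?thesis by (auto intro: dvd_mult2)
  qed
qed

lemma finite_monic_prime_divisors:
  fixes x :: "'a::finite_field poly"
  assumes "x \<noteq> 0"
  shows "finite {P. monic_prime P \<and> P dvd x}"
  by (rule finite_subset[OF _ finite_degree_less[of "Suc (degree x)"]])
    (use assms in \<open>auto simp: less_Suc_eq_le dvd_imp_degree_le\<close>)

text \<open>The library's \<open>multiplicity\<close> needs a \<open>factorial_semiring\<close>, which polynomials
  over an abstract field do not form.\<close>

definition pval :: "'a::field poly \<Rightarrow> 'a poly \<Rightarrow> nat" where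
  "pval P x = (GREATEST n. P ^ n dvd x)"

context
  fixes P :: "'a::finite_field poly"
  assumes P: "monic_prime P"
begin

lemma pval_eqI:
  assumes "x = P ^ n * y" "\<not> P dvd y"
  shows "pval P x = n"
  unfolding pval_def
proof (rule Greatest_equality)
  show "k \<le> n" if "P ^ k dvd x" for k
  proof (rule ccontr)
    assume "\<not> k \<le> n"
    then have "P ^ Suc n dvd x" using that by (meson le_imp_power_dvd dvd_trans not_less_eq_eq)
    then show False using assms P by (simp add: mult.commute[of P] monic_primeD)
  qed
qed (simp add: assms)

lemma pval_decompose:
  assumes "x \<noteq> 0"
  obtains y where "x = P ^ pval P x * y" "\<not> P dvd y"
proof -
  have "\<exists>n y. x = P ^ n * y \<and> \<not> P dvd y" using assms
  proof (induction "degree x" arbitrary: x rule: less_induct)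
    case less
    show ?case
    proof (cases "P dvd x")
      case True
      then obtain z where z: "x = P * z" by auto
      then have "degree z < degree x" "z \<noteq> 0"
        using less.prems monic_prime_degree_pos[OF P] by (auto simp: degree_mult_eq)
      from less.hyps[OF this] obtain n y where "z = P ^ n * y" "\<not> P dvd y" by auto
      then have "x = P ^ Suc n * y" "\<not> P dvd y" using z by (auto simp: mult.assoc)
      then show ?thesis by blast
    next
      case False
      then show ?thesis by (intro exI[of _ 0] exI[of _ x]) simp
    qed
  qed
  then show ?thesis using that pval_eqI by metis
qed

lemma pval_mult:
  assumes "x \<noteq> 0" "y \<noteq> 0"
  shows "pval P (x * y) = pval P x + pval P y"
proof -
  from assms obtain a b where
    "x = P ^ pval P x * a" "\<not> P dvd a" "y = P ^ pval P y * b" "\<not> P dvd b"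
    using pval_decompose by metis
  then have "x * y = (P ^ pval P x * a) * (P ^ pval P y * b)" "\<not> P dvd a * b"
    using P prime_elem_dvd_mult_iff monic_primeD(1) by metis+
  then have "x * y = P ^ (pval P x + pval P y) * (a * b)" "\<not> P dvd a * b"
    by (simp_all only: power_add mult_ac simp_thms)
  then show ?thesis by (rule pval_eqI)
qed

lemma power_dvd_iff_le_pval: "x \<noteq> 0 \<Longrightarrow> P ^ n dvd x \<longleftrightarrow> n \<le> pval P x"
proof
  assume "x \<noteq> 0" and dvd: "P ^ n dvd x"
  then obtain y where y: "x = P ^ n * y" by auto
  then have "pval P (P ^ n) = n" "y \<noteq> 0"
    using \<open>x \<noteq> 0\<close> P by (auto intro: pval_eqI[of _ _ 1] simp: monic_primeD)
  with y P show "n \<le> pval P x" by (simp add: pval_mult monic_primeD)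
next
  assume "x \<noteq> 0" "n \<le> pval P x"
  then show "P ^ n dvd x" by (metis pval_decompose dvd_triv_left le_imp_power_dvd dvd_trans)
qed

lemma pval_eq_0: "\<not> P dvd x \<Longrightarrow> pval P x = 0"
  by (rule pval_eqI) auto

lemma pval_pos_iff: "x \<noteq> 0 \<Longrightarrow> 0 < pval P x \<longleftrightarrow> P dvd x"
  using power_dvd_iff_le_pval[of x 1] by auto

lemma pval_self_power: "pval P (P ^ n) = n"
  by (rule pval_eqI[of _ _ 1]) (use P in \<open>auto simp: monic_primeD\<close>)

lemma pval_self: "pval P P = 1"
  using pval_self_power[of 1] by simp

lemma pval_other: "monic_prime R \<Longrightarrow> pval P R = (if R = P then 1 else 0)"
  using P by (auto simp: pval_self monic_prime_dvd_iff_eq intro!: pval_eq_0)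

end

text \<open>\<open>M\<close> may exceed the set of prime divisors of \<open>x\<close>, so that a
  single \<open>M\<close> serves all values \<open>C_n(u)\<close> with \<open>n\<close> dividing
  \<open>m\<close>.\<close>

lemma degree_eq_sum_pval:
  fixes x :: "'a::finite_field poly"
  assumes "x \<noteq> 0" "finite M" "\<And>P. P \<in> M \<Longrightarrow> monic_prime P"
    "\<And>P. monic_prime P \<Longrightarrow> P dvd x \<Longrightarrow> P \<in> M"
  shows "degree x = (\<Sum>P\<in>M. degree P * pval P x)"
  using assms
proof (induction "degree x" arbitrary: x rule: less_induct)
  case less
  show ?case
  proof (cases "degree x = 0")
    case True
    then have "is_unit x" using less.prems by (simp add: is_unit_iff_degree)
    then have "pval P x = 0" if "P \<in> M" for P
      using less.prems(3)[OF that] by (meson pval_eq_0 dvd_trans monic_primeD(3))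
    then show ?thesis using True by simp
  next
    case False
    then obtain R where R: "monic_prime R" and "R dvd x"
      using monic_prime_divisor_exists[of x] by auto
    then obtain y where x: "x = R * y" by auto
    have RM: "R \<in> M" using less.prems(4)[of R] R x by simp
    have "y \<noteq> 0" using less.prems x by auto
    have dx: "degree x = degree R + degree y"
      using x \<open>y \<noteq> 0\<close> R by (simp add: degree_mult_eq monic_primeD)
    have "(\<Sum>P\<in>M. degree P * pval P x) = (\<Sum>P\<in>M. degree P * pval P R + degree P * pval P y)"
      using less.prems(3) \<open>y \<noteq> 0\<close> R
      by (intro sum.cong) (auto simp: x pval_mult monic_primeD distrib_left)
    also have "\<dots> = (\<Sum>P\<in>M. if P = R then degree R else 0) + (\<Sum>P\<in>M. degree P * pval P y)"
      unfolding sum.distrib using less.prems(3) R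
      by (intro arg_cong2[where f = "(+)"] sum.cong) (auto simp: pval_other)
    also have "(\<Sum>P\<in>M. degree P * pval P y) = degree y"
      by (rule less.hyps[symmetric])
        (use dx monic_prime_degree_pos[OF R] \<open>y \<noteq> 0\<close> less.prems x in auto)
    finally show ?thesis using RM less.prems(2) dx by simp
  qed
qed

section \<open>Orders modulo a prime\<close>

definition carlitz_order :: "'a::finite_field poly \<Rightarrow> 'a poly \<Rightarrow> 'a poly" where
  "carlitz_order u P = (SOME n. lead_coeff n = 1 \<and> (\<forall>a. P dvd carlitz_eval a u \<longleftrightarrow> n dvd a))"

text \<open>The annihilator of \<open>u\<close> modulo \<open>P\<close> is nonzero since it contains
  \<open>P - 1\<close>; an element of least degree, made monic, divides all others by division with
  remainder.\<close>

lemma carlitz_order: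
  fixes P u :: "'a::finite_field poly"
  assumes P: "monic_prime P"
  shows lead_coeff_carlitz_order: "lead_coeff (carlitz_order u P) = 1"
    and dvd_carlitz_eval_iff: "P dvd carlitz_eval a u \<longleftrightarrow> carlitz_order u P dvd a"
proof -
  define I where "I = (\<lambda>n. n \<noteq> 0 \<and> P dvd carlitz_eval n u)"
  have "P - 1 \<noteq> 0" using monic_prime_degree_pos[OF P] by auto
  then have "I (P - 1)" using prime_dvd_carlitz_eval_minus_1[OF P] by (simp add: I_def)
  then obtain n where n: "I n" and min: "\<And>k. degree k < degree n \<Longrightarrow> \<not> I k"
    using exists_least_iff[of "\<lambda>d. \<exists>n. degree n = d \<and> I n"] by metis
  define c where "c = inverse (lead_coeff n)"
  define b where "b = smult c n"
  have c: "c \<noteq> 0" and n0: "n \<noteq> 0" using n by (auto simp: c_def I_def)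
  have b1: "lead_coeff b = 1" using n0 by (simp add: b_def c_def)
  have "P dvd carlitz_eval n u" using n by (simp add: I_def)
  also have "carlitz_eval n u dvd carlitz_eval b u"
    by (rule dvd_carlitz_eval) (simp add: b_def dvd_smult)
  finally have Pb: "P dvd carlitz_eval b u" .
  have "P dvd carlitz_eval a u \<longleftrightarrow> b dvd a" for a
  proof
    assume a: "P dvd carlitz_eval a u"
    have "carlitz_eval (a mod b) u = carlitz_eval a u - carlitz_eval (a div b * b) u"
      by (simp add: carlitz_eval_diff[symmetric] minus_div_mult_eq_mod)
    moreover have "P dvd carlitz_eval (a div b * b) u"
      using Pb by (rule dvd_trans) (simp add: dvd_carlitz_eval)
    ultimately have "P dvd carlitz_eval (a mod b) u" using a by simp
    moreover have "a mod b = 0 \<or> degree (a mod b) < degree n"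
      using degree_mod_less[of b a] c n0 by (auto simp: b_def)
    ultimately have "a mod b = 0" using min[of "a mod b"] by (auto simp: I_def)
    then show "b dvd a" by (simp add: mod_eq_0_iff_dvd)
  next
    assume "b dvd a"
    then show "P dvd carlitz_eval a u" using Pb dvd_carlitz_eval dvd_trans by blast
  qed
  then have "\<exists>n. lead_coeff n = 1 \<and> (\<forall>a. P dvd carlitz_eval a u \<longleftrightarrow> n dvd a)" using b1 by blast
  from someI_ex[OF this]
  show "lead_coeff (carlitz_order u P) = 1" "P dvd carlitz_eval a u \<longleftrightarrow> carlitz_order u P dvd a"
    unfolding carlitz_order_def by blast+
qed

lemma carlitz_order_dvd_minus_1: "monic_prime P \<Longrightarrow> carlitz_order u P dvd P - 1"
  using prime_dvd_carlitz_eval_minus_1 by (simp flip: dvd_carlitz_eval_iff)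

text \<open>The order annihilates \<open>u\<close> modulo \<open>P\<close>, so minimality of
  \<open>m\<close> bounds \<open>degree m\<close> by the degree of the order, which in turn divides
  \<open>m\<close>; both are monic, hence equal.\<close>

lemma zsigmondy_prime_iff:
  fixes m u P :: "'a::finite_field poly"
  assumes m: "lead_coeff m = 1"
  shows "zsigmondy_prime u m P \<longleftrightarrow> monic_prime P \<and> carlitz_order u P = m"
proof (cases "monic_prime P")
  case P: True
  let ?o = "carlitz_order u P"
  have o: "lead_coeff ?o = 1" by (rule lead_coeff_carlitz_order[OF P])
  show ?thesis
  proof
    assume "zsigmondy_prime u m P"
    then have "?o dvd m" and *: "\<And>n. n \<noteq> 0 \<Longrightarrow> degree n < degree m \<Longrightarrow> \<not> ?o dvd n"
      by (auto simp: zsigmondy_prime_def dvd_carlitz_eval_iff[OF P])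
    moreover have "degree m \<le> degree ?o" using *[of ?o] o by force
    ultimately show "monic_prime P \<and> carlitz_order u P = m"
      using P o m by (auto intro: monic_dvd_antisym)
  next
    assume "monic_prime P \<and> carlitz_order u P = m"
    then show "zsigmondy_prime u m P"
      by (auto simp: zsigmondy_prime_def dvd_carlitz_eval_iff dest: dvd_imp_degree_le)
  qed
qed (simp add: zsigmondy_prime_def)

section \<open>Lifting the exponent\<close>

text \<open>As \<open>q > 2\<close>, the term \<open>x ^ q\<close> is too divisible by \<open>P\<close> to affect the valuation.\<close>

lemma pval_carlitz_eval_step:
  fixes x k :: "'a::finite_field poly"
  assumes P: "monic_prime P" and q: "CARD('a) > 2"
    and x: "x \<noteq> 0" "P dvd x" and k: "k \<noteq> 0" "pval P k \<le> 1"
  shows "carlitz_eval k x \<noteq> 0 \<and> pval P (carlitz_eval k x) = pval P x + pval P k"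
proof -
  let ?v = "pval P x" and ?a = "pval P k"
  obtain y where y: "k * x = P ^ (?v + ?a) * y" "\<not> P dvd y"
    using pval_decompose[OF P, of "k * x"] pval_mult[OF P k(1) x(1)] x k by (auto simp: add.commute)
  have "?v > 0" using x pval_pos_iff[OF P] by simp
  \<comment> \<open>\<open>3 * ?v \<ge> ?v + ?a + 1\<close> because \<open>?v \<ge> 1\<close> and
    \<open>?a \<le> 1\<close>. With \<open>q = 2\<close> the bound would fail at
    \<open>?v = ?a = 1\<close>.\<close>
  then have "?v * 3 \<le> ?v * CARD('a)" "?v + ?a + 1 \<le> ?v * 3" using q k(2) by (auto simp del: mult_le_mono2)
  then have le: "?v + ?a + 1 \<le> ?v * CARD('a)" by linarith
  have "P ^ (?v + ?a + 1) dvd P ^ (?v * CARD('a))" using le by (rule le_imp_power_dvd)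
  also have "\<dots> dvd x ^ CARD('a)"
    unfolding power_mult by (intro dvd_power_same) (simp add: power_dvd_iff_le_pval[OF P x(1)])
  also have "\<dots> dvd carlitz_eval k x - k * x" by (rule carlitz_eval_linear_part)
  finally obtain w where "carlitz_eval k x - k * x = P ^ (?v + ?a + 1) * w" by auto
  then have "carlitz_eval k x = P ^ (?v + ?a) * (y + P * w)"
    using y(1) by (simp add: algebra_simps)
  moreover have "\<not> P dvd y + P * w" using y(2) by (simp add: dvd_add_left_iff)
  ultimately show ?thesis using pval_eqI[OF P] P by (auto simp: monic_primeD)
qed

text \<open>The one-step estimate covers only \<open>pval P k \<le> 1\<close>, so the factors
  \<open>P\<close> of \<open>k\<close> are applied one at a time, each raising the valuation by
  exactly 1.\<close>

lemma pval_carlitz_eval: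
  fixes x k :: "'a::finite_field poly"
  assumes P: "monic_prime P" and q: "CARD('a) > 2" and x: "x \<noteq> 0" "P dvd x" and "k \<noteq> 0"
  shows "carlitz_eval k x \<noteq> 0 \<and> pval P (carlitz_eval k x) = pval P x + pval P k"
  using \<open>k \<noteq> 0\<close>
proof (induction "pval P k" arbitrary: k)
  case 0
  then show ?case using pval_carlitz_eval_step[OF P q x, of k] by simp
next
  case (Suc n)
  then have "P dvd k" using pval_pos_iff[OF P, of k] by simp
  then obtain l where k: "k = P * l" by auto
  then have "l \<noteq> 0" using Suc by auto
  then have v: "pval P k = Suc (pval P l)"
    using k P by (simp add: pval_mult[OF P] pval_self monic_primeD)
  let ?y = "carlitz_eval l x"
  have y: "?y \<noteq> 0" "pval P ?y = pval P x + pval P l" using Suc \<open>l \<noteq> 0\<close> v by auto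
  have "P dvd ?y" using x(2) dvd_carlitz_eval_self dvd_trans by blast
  with pval_carlitz_eval_step[OF P q y(1), of P] y P v show ?case
    by (simp add: k carlitz_eval_mult pval_self monic_primeD)
qed

section \<open>Degrees of the values of the Carlitz module\<close>

text \<open>In \<open>c u + T y + y ^ q\<close> with \<open>y = C_a(u)\<close> of degree
  \<open>d \<ge> 1\<close>, the last term dominates since \<open>q d \<ge> 3 d > d + 1\<close>; each
  step multiplies the degree by \<open>q\<close>.\<close>

lemma degree_carlitz_eval_of_degree_pos:
  fixes n u :: "'a::finite_field poly"
  assumes q: "CARD('a) > 2" and u: "degree u > 0" and "n \<noteq> 0"
  shows "degree (carlitz_eval n u) = degree u * CARD('a) ^ degree n"
  using \<open>n \<noteq> 0\<close>
proof (induction n)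
  case (pCons c a)
  show ?case
  proof (cases "a = 0")
    case True
    then show ?thesis using pCons by (simp add: carlitz_eval_const)
  next
    case False
    let ?y = "carlitz_eval a u"
    have y: "degree ?y = degree u * CARD('a) ^ degree a" using pCons False by simp
    then have "degree u \<le> degree ?y" by simp
    then have "degree ?y > 0" "?y \<noteq> 0" using u by auto
    have "3 * degree ?y \<le> CARD('a) * degree ?y" using q by (intro mult_le_mono1) simp
    then have "3 * degree ?y \<le> degree (?y ^ CARD('a))"
      using \<open>?y \<noteq> 0\<close> by (simp add: degree_power_eq)
    then have less: "degree ?y + 1 < degree (?y ^ CARD('a))"
      using \<open>degree ?y > 0\<close> by linarith
    have "degree (T * ?y) = degree ?y + 1" using \<open>?y \<noteq> 0\<close> by (simp add: degree_pCons_eq)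
    then have "degree (smult c u + T * ?y) < degree (?y ^ CARD('a))"
      using less \<open>degree u \<le> degree ?y\<close> degree_smult_le[of c u]
      by (intro degree_add_less) linarith+
    then show ?thesis
      unfolding carlitz_eval_pCons
      using False y \<open>?y \<noteq> 0\<close> by (simp add: degree_add_eq_right degree_power_eq)
  qed
qed simp

text \<open>Growth by the factor \<open>q\<close> starts one step late: for constant
  \<open>a\<close> the value \<open>C_a(1)\<close> is constant, its \<open>q\<close>-th power does
  not dominate, and \<open>T * C_a(1)\<close> brings the degree to 1 only.\<close>

lemma degree_carlitz_eval_1:
  fixes n :: "'a::finite_field poly"
  assumes q: "CARD('a) > 2" and "n \<noteq> 0"
  shows "degree (carlitz_eval n 1) = (if degree n = 0 then 0 else CARD('a) ^ (degree n - 1))"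
  using \<open>n \<noteq> 0\<close>
proof (induction n)
  case (pCons c a)
  consider "a = 0" | "a \<noteq> 0" "degree a = 0" | "degree a > 0" by auto
  then show ?case
  proof cases
    case 1
    then show ?thesis by (simp add: carlitz_eval_const)
  next
    case 2
    then obtain d where d: "a = [:d:]" "d \<noteq> 0" by (metis degree_eq_zeroE pCons_0_0)
    then have "carlitz_eval (pCons c a) 1 = [:c + d:] + T * [:d:]"
      by (simp add: carlitz_eval_pCons carlitz_eval_const smult_one poly_const_pow
          finite_field_power_card_eq_same add_ac one_pCons power_0_left)
    then show ?thesis using d by simp
  next
    case 3
    let ?y = "carlitz_eval a 1"
    have "a \<noteq> 0" using 3 by auto
    then have y: "degree ?y = CARD('a) ^ (degree a - 1)" using pCons 3 by simp
    then have "degree ?y > 0" by simp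
    then have "?y \<noteq> 0" by auto
    have "3 * degree ?y \<le> CARD('a) * degree ?y" using q by (intro mult_le_mono1) simp
    then have "3 * degree ?y \<le> degree (?y ^ CARD('a))"
      using \<open>?y \<noteq> 0\<close> by (simp add: degree_power_eq)
    then have less: "degree ?y + 1 < degree (?y ^ CARD('a))"
      using \<open>degree ?y > 0\<close> by linarith
    have "degree (T * ?y) = degree ?y + 1" using \<open>?y \<noteq> 0\<close> by (simp add: degree_pCons_eq)
    then have "degree (smult c 1 + T * ?y) < degree (?y ^ CARD('a))"
      using less degree_smult_le[of c "1 :: 'a poly"] by (intro degree_add_less) simp_all
    then have "degree (carlitz_eval (pCons c a) 1) = CARD('a) ^ Suc (degree a - 1)"
      unfolding carlitz_eval_pCons
      using y \<open>?y \<noteq> 0\<close> by (simp add: degree_add_eq_right degree_power_eq)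
    then show ?thesis using 3 by auto
  qed
qed simp

lemma monic_degree_0: "lead_coeff u = 1 \<Longrightarrow> degree u = 0 \<Longrightarrow> u = 1"
  by (metis degree_eq_zeroE coeff_pCons_0 degree_pCons_0 one_pCons)

lemma carlitz_eval_neq_0:
  fixes n u :: "'a::finite_field poly"
  assumes q: "CARD('a) > 2" and u: "lead_coeff u = 1" and n: "n \<noteq> 0"
  shows "carlitz_eval n u \<noteq> 0"
proof (cases "degree n = 0")
  case True
  then obtain c where "n = [:c:]" by (metis degree_eq_zeroE)
  with n u show ?thesis by (auto simp: carlitz_eval_const)
next
  case False
  show ?thesis
  proof (cases "degree u = 0")
    case True
    with u have "u = 1" by (rule monic_degree_0)
    then have "degree (carlitz_eval n u) > 0" using degree_carlitz_eval_1[OF q n] False by simp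
    then show ?thesis by auto
  next
    case False
    then have "degree (carlitz_eval n u) > 0"
      using degree_carlitz_eval_of_degree_pos[OF q _ n, of u] by simp
    then show ?thesis by auto
  qed
qed

section \<open>Moebius inversion\<close>

definition monic_primes_of :: "'a::finite_field poly \<Rightarrow> 'a poly set" where
  "monic_primes_of m = {R. monic_prime R \<and> R dvd m}"

text \<open>This is the sum of \<open>\<mu>(d) g(m / d)\<close> over the monic divisors
  \<open>d\<close> of \<open>m\<close>. As \<open>\<mu>\<close> vanishes off squarefree divisors,
  \<open>d\<close> is indexed by the set \<open>B\<close> of its prime factors.\<close>

definition moebius_sum :: "'a::finite_field poly \<Rightarrow> ('a poly \<Rightarrow> int) \<Rightarrow> int" where
  "moebius_sum m g = (\<Sum>B\<in>Pow (monic_primes_of m). (- 1) ^ card B * g (m div \<Prod>B))"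

lemma finite_monic_primes_of: "m \<noteq> 0 \<Longrightarrow> finite (monic_primes_of m)"
  unfolding monic_primes_of_def by (rule finite_monic_prime_divisors)

lemma sum_Pow_insert:
  assumes "finite A" "x \<notin> A"
  shows "sum f (Pow (insert x A)) = (\<Sum>B\<in>Pow A. f B + f (insert x B))"
proof -
  have "sum f (Pow (insert x A)) = sum f (Pow A) + sum f (insert x ` Pow A)"
    unfolding Pow_insert by (rule sum.union_disjoint) (use assms in auto)
  also have "sum f (insert x ` Pow A) = (\<Sum>B\<in>Pow A. f (insert x B))"
    by (subst sum.reindex) (use assms in \<open>auto intro!: inj_onI simp: o_def\<close>)
  finally show ?thesis by (simp add: sum.distrib)
qed

lemma monic_prime_dvd_prod_iff:
  assumes "finite B" "\<And>R. R \<in> B \<Longrightarrow> monic_prime R" "monic_prime P"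
  shows "P dvd \<Prod>B \<longleftrightarrow> P \<in> B"
  using assms(1,2)
  by (induction B) (auto simp: prime_elem_dvd_mult_iff monic_primeD[OF assms(3)] monic_prime_dvd_iff_eq assms(3))

lemma prod_monic_primes_dvd:
  assumes "finite B" "\<And>R. R \<in> B \<Longrightarrow> monic_prime R \<and> R dvd x"
  shows "\<Prod>B dvd x"
  using assms
proof (induction B)
  case (insert R B)
  then obtain t where t: "x = \<Prod>B * t" by (auto elim: dvdE)
  have "\<not> R dvd \<Prod>B" using insert by (subst monic_prime_dvd_prod_iff) auto
  then have "R dvd t"
    using insert.prems[of R] t by (auto simp: prime_elem_dvd_mult_iff monic_primeD)
  then show ?case using insert.hyps t by (simp add: mult.commute mult_dvd_mono)
qed simp

lemma lead_coeff_prod_monic: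
  "(\<And>R. R \<in> B \<Longrightarrow> lead_coeff R = (1::'a::idom)) \<Longrightarrow> lead_coeff (\<Prod>B) = 1"
  by (simp add: lead_coeff_prod)

lemma degree_prod_monic_primes:
  "(\<And>R. R \<in> B \<Longrightarrow> monic_prime R) \<Longrightarrow> degree (\<Prod>B) = (\<Sum>R\<in>B. degree R)"
  by (rule degree_prod_eq_sum_degree) (auto simp: monic_primeD)

lemma monic_div:
  assumes "lead_coeff m = 1" "lead_coeff a = (1::'a::field)" "a dvd m"
  shows "lead_coeff (m div a) = 1" "m div a \<noteq> 0" "m = a * (m div a)"
    "degree (m div a) = degree m - degree a"
proof -
  show m: "m = a * (m div a)" using assms by simp
  then have "lead_coeff m = lead_coeff a * lead_coeff (m div a)" by (metis lead_coeff_mult)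
  then show "lead_coeff (m div a) = 1" using assms by simp
  then show n0: "m div a \<noteq> 0" by auto
  have "a \<noteq> 0" using assms by auto
  then have "degree m = degree a + degree (m div a)" using m n0 by (metis degree_mult_eq)
  then show "degree (m div a) = degree m - degree a" by simp
qed

context
  fixes m :: "'a::finite_field poly"
  assumes m: "lead_coeff m = 1"
begin

lemma moebius_sum_subset:
  assumes "B \<subseteq> monic_primes_of m"
  shows "finite B" "\<Prod>B dvd m" "lead_coeff (\<Prod>B) = 1"
proof -
  have "m \<noteq> 0" using m by auto
  then show fin: "finite B" using finite_monic_primes_of assms finite_subset by blast
  then show "\<Prod>B dvd m" using assms by (intro prod_monic_primes_dvd) (auto simp: monic_primes_of_def)
  show "lead_coeff (\<Prod>B) = 1"
    using assms by (intro lead_coeff_prod_monic) (auto simp: monic_primes_of_def monic_primeD)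
qed

lemma moebius_sum_div:
  assumes "B \<subseteq> monic_primes_of m"
  shows "lead_coeff (m div \<Prod>B) = 1" "m div \<Prod>B \<noteq> 0" "m = \<Prod>B * (m div \<Prod>B)"
    "degree (m div \<Prod>B) = degree m - degree (\<Prod>B)"
  using monic_div[OF m moebius_sum_subset(3)[OF assms] moebius_sum_subset(2)[OF assms]] by blast+

text \<open>The valuation \<open>v n\<close> is 0 unless \<open>b\<close> divides \<open>n\<close>,
  and \<open>v (b * k) = c + pval P k\<close>. With \<open>m = b * s\<close> this makes the sum one
  of von Mangoldt type in \<open>s\<close>: it is \<open>c\<close> for \<open>s = 1\<close>, 1 for a
  positive power of \<open>P\<close>, and 0 for all other \<open>s\<close>.\<close>

lemma moebius_sum_pval:
  fixes u P :: "'a poly"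
  assumes q: "CARD('a) > 2" and u: "lead_coeff u = 1" and P: "monic_prime P"
  defines "b \<equiv> carlitz_order u P"
  shows "moebius_sum m (\<lambda>n. int (pval P (carlitz_eval n u))) =
    (if b = m then int (pval P (carlitz_eval m u)) else if \<exists>k>0. m = b * P ^ k then 1 else 0)"
proof -
  let ?S = "monic_primes_of m"
  define v where "v n = int (pval P (carlitz_eval n u))" for n
  define c where "c = v b"
  have fin: "finite ?S" using m by (intro finite_monic_primes_of) auto
  have b: "lead_coeff b = 1" unfolding b_def by (rule lead_coeff_carlitz_order[OF P])
  then have b0: "b \<noteq> 0" by auto
  have v0: "v n = 0" if "\<not> b dvd n" for n
    using that by (simp add: v_def pval_eq_0[OF P] dvd_carlitz_eval_iff[OF P] b_def)
  have vb: "v (b * k) = c + int (pval P k)" if "k \<noteq> 0" for k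
    using pval_carlitz_eval[OF P q carlitz_eval_neq_0[OF q u b0] _ that]
      dvd_carlitz_eval_iff[OF P, of b u]
    by (simp add: v_def c_def b_def mult.commute[of _ k] carlitz_eval_mult)
  have sum_eq: "moebius_sum m v = (\<Sum>B\<in>Pow ?S. (- 1) ^ card B * v (m div \<Prod>B))"
    by (simp add: moebius_sum_def)
  have "moebius_sum m v = (if b = m then v m else if \<exists>k>0. m = b * P ^ k then 1 else 0)"
  proof (cases "b dvd m")
    case False
    have "(- 1) ^ card B * v (m div \<Prod>B) = 0" if "B \<in> Pow ?S" for B
    proof -
      have "m div \<Prod>B dvd m" using moebius_sum_div(3)[of B] that by (metis PowD dvd_triv_right)
      then have "\<not> b dvd m div \<Prod>B" using False dvd_trans by blast
      then show ?thesis by (simp add: v0)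
    qed
    then show ?thesis using False unfolding sum_eq by (subst sum.neutral) auto
  next
    case True
    then obtain s where s: "m = b * s" by auto
    have s0: "s \<noteq> 0" and sl: "lead_coeff s = 1" using s m b by (auto simp: lead_coeff_mult)
    have m_b: "b = m \<longleftrightarrow> s = 1" and m_k: "m = b * P ^ k \<longleftrightarrow> s = P ^ k" for k
      using b0 by (auto simp: s)
    show ?thesis
    proof (cases "\<exists>R. monic_prime R \<and> R dvd s \<and> R \<noteq> P")
      case True
      then obtain R where R: "monic_prime R" "R dvd s" "R \<noteq> P" by auto
      have RS: "R \<in> ?S" using R s by (simp add: monic_primes_of_def)
      let ?S' = "?S - {R}"
      \<comment> \<open>Pairing \<open>B\<close> with \<open>insert R B\<close> makes the sum
        cancel: restoring the factor \<open>R\<close> changes neither divisibility by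
        \<open>b\<close> nor the valuation at \<open>P\<close>.\<close>
      have "v (m div \<Prod>B) = v (m div \<Prod>(insert R B))" if B: "B \<in> Pow ?S'" for B
      proof -
        have BS: "B \<subseteq> ?S" "insert R B \<subseteq> ?S" "R \<notin> B" and finB: "finite B"
          using B RS finite_subset[OF _ fin] by auto
        have notR: "\<not> R dvd \<Prod>B"
          using BS finB R by (subst monic_prime_dvd_prod_iff) (auto simp: monic_primes_of_def)
        define t where "t = m div \<Prod>(insert R B)"
        have t0: "t \<noteq> 0" and mt: "m = R * \<Prod>B * t"
          using moebius_sum_div[OF BS(2)] finB BS(3) by (auto simp: t_def)
        have "\<Prod>B \<noteq> 0" using moebius_sum_subset(3)[OF BS(1)] by auto
        then have mB: "m div \<Prod>B = R * t"
          unfolding mt by (simp add: mult.commute[of R] mult.assoc)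
        have "v (R * t) = v t"
        proof (cases "b dvd t")
          case True
          then obtain k where k: "t = b * k" by auto
          then have "k \<noteq> 0" using t0 by auto
          then show ?thesis using R vb[of k] vb[of "R * k"]
            by (simp add: k mult.left_commute[of R] pval_mult[OF P] pval_other[OF P] monic_primeD)
        next
          case False
          have "\<not> b dvd R * t"
          proof
            assume "b dvd R * t"
            then obtain k where k: "R * t = b * k" by auto
            \<comment> \<open>\<open>R\<close> divides \<open>s = \<Prod>B * k\<close> but not
              \<open>\<Prod>B\<close>, so it divides \<open>k\<close> and cancels from
              \<open>R * t = b * k\<close>.\<close>
            have "b * s = b * (\<Prod>B * k)"
              using mt s k by (metis mult.assoc mult.left_commute)
            then have "R dvd k" using R b0 notR
              by (auto simp: prime_elem_dvd_mult_iff monic_primeD)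
            then obtain l where "k = R * l" by auto
            then have "R * t = R * (b * l)" using k by (simp add: mult.left_commute)
            then show False using False R by (auto simp: monic_primeD)
          qed
          then show ?thesis using False by (simp add: v0)
        qed
        then show ?thesis by (simp add: mB t_def)
      qed
      moreover have "card (insert R B) = Suc (card B)" if "B \<in> Pow ?S'" for B
        using that finite_subset[OF _ fin, of B] by (subst card_insert_disjoint) auto
      moreover have "?S = insert R ?S'" using RS by auto
      moreover have "s \<noteq> 1" "s \<noteq> P ^ k" for k
        using R monic_primeD[OF R(1)] P prime_elem_dvd_power[of R P k]
        by (auto simp: monic_prime_dvd_iff_eq)
      ultimately show ?thesis
        unfolding sum_eq m_b m_k using fin by (subst \<open>?S = _\<close>, subst sum_Pow_insert) auto
    next
      case False
      \<comment> \<open>Now \<open>s\<close> has no prime factor other than possibly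
        \<open>P\<close>, and \<open>b\<close> divides \<open>m div \<Prod>B\<close> only if
        \<open>\<Prod>B\<close> divides \<open>s\<close>; so at most \<open>{}\<close> and
        \<open>{P}\<close> contribute.\<close>
      have small: "B \<subseteq> {P}" if "B \<in> Pow ?S" "b dvd m div \<Prod>B" for B
      proof
        fix R assume R: "R \<in> B"
        obtain k where "m div \<Prod>B = b * k" using \<open>b dvd m div \<Prod>B\<close> by auto
        then have "b * s = b * (\<Prod>B * k)"
          using moebius_sum_div(3)[of B] that(1) s by (metis PowD mult.left_commute)
        then have "s = \<Prod>B * k" using b0 by simp
        moreover have "R dvd \<Prod>B" "monic_prime R"
          using R that(1) finite_subset[OF _ fin, of B] by (auto simp: monic_primes_of_def intro: dvd_prodI)
        ultimately show "R \<in> {P}" using False by auto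
      qed
      show ?thesis
      proof (cases "P dvd s")
        case True
        then have PS: "{{}, {P}} \<subseteq> Pow ?S" using P s by (auto simp: monic_primes_of_def)
        have "moebius_sum m v = (\<Sum>B\<in>{{}, {P}}. (- 1) ^ card B * v (m div \<Prod>B))"
          unfolding sum_eq
        proof (rule sum.mono_neutral_right)
          show "\<forall>B\<in>Pow ?S - {{}, {P}}. (- 1) ^ card B * v (m div \<Prod>B) = 0"
          proof
            fix B assume B: "B \<in> Pow ?S - {{}, {P}}"
            then have "\<not> b dvd m div \<Prod>B" using small[of B] by (auto simp: subset_singleton_iff)
            then show "(- 1) ^ card B * v (m div \<Prod>B) = 0" by (simp add: v0)
          qed
        qed (use fin PS in auto)
        also have "\<dots> = v m - v (m div P)" by simp
        also obtain t where t: "s = P * t" using True by auto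
        then have "t \<noteq> 0" using s0 by auto
        have "m div P = b * t"
          using monic_primeD(2)[OF P] by (simp add: s t mult.left_commute)
        then have "v m - v (m div P) = 1"
          using vb[of s] vb[of t] s0 \<open>t \<noteq> 0\<close> P by (simp add: s t pval_mult[OF P] pval_self monic_primeD)
        finally have sum1: "moebius_sum m v = 1" .
        obtain y where y: "s = P ^ pval P s * y" "\<not> P dvd y" using pval_decompose[OF P s0] by auto
        have "degree y = 0"
        proof (rule ccontr)
          assume "degree y \<noteq> 0"
          then obtain R where "monic_prime R" "R dvd y" using monic_prime_divisor_exists[of y] by auto
          with y False show False by (metis dvd_mult)
        qed
        moreover have "lead_coeff y = 1"
        proof -
          have "lead_coeff s = lead_coeff P ^ pval P s * lead_coeff y"
            using y(1) by (metis lead_coeff_mult lead_coeff_power)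
          then show ?thesis using sl monic_primeD(4)[OF P] by simp
        qed
        ultimately have "s = P ^ pval P s" using y(1) monic_degree_0[of y] by simp
        moreover have "pval P s > 0" using True s0 pval_pos_iff[OF P] by simp
        moreover have "s \<noteq> 1" using True monic_primeD[OF P] by auto
        ultimately show ?thesis using sum1 unfolding m_b m_k by auto
      next
        case nP: False
        have "degree s = 0"
          using monic_prime_divisor_exists[of s] False nP by auto
        then have s1: "s = 1" using sl by (intro monic_degree_0)
        have "moebius_sum m v = (\<Sum>B\<in>{{}}. (- 1) ^ card B * v (m div \<Prod>B))"
          unfolding sum_eq
        proof (rule sum.mono_neutral_right)
          have "\<not> b dvd m div P" if "P dvd m"
          proof
            assume "b dvd m div P"
            then have "degree b \<le> degree (m div P)"
              using monic_div(2)[OF m monic_primeD(4)[OF P] that] by (rule dvd_imp_degree_le)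
            moreover have "m \<noteq> 0" using m by auto
            then have "degree P \<le> degree m" using that by (rule dvd_imp_degree_le[rotated])
            moreover have "degree m = degree b" using s s1 by simp
            ultimately show False
              using monic_div(4)[OF m monic_primeD(4)[OF P] that] monic_prime_degree_pos[OF P] by simp
          qed
          note notP = this
          show "\<forall>B\<in>Pow ?S - {{}}. (- 1) ^ card B * v (m div \<Prod>B) = 0"
          proof
            fix B assume B: "B \<in> Pow ?S - {{}}"
            have "\<not> b dvd m div \<Prod>B"
            proof
              assume *: "b dvd m div \<Prod>B"
              with small[of B] B have "B = {P}" by (auto simp: subset_singleton_iff)
              with B * notP show False by (auto simp: monic_primes_of_def)
            qed
            then show "(- 1) ^ card B * v (m div \<Prod>B) = 0" by (simp add: v0)
          qed
        qed (use fin in auto)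
        then show ?thesis unfolding m_b using s1 by simp
      qed
    qed
  qed
  then show ?thesis unfolding v_def .
qed

end

text \<open>The primes dividing the value at \<open>u\<close> of the \<open>m\<close>-th cyclotomic factor of \<open>C\<^sub>m\<close>
  without being Zsigmondy primes.\<close>

definition special_primes :: "'a::finite_field poly \<Rightarrow> 'a poly \<Rightarrow> 'a poly set" where
  "special_primes u m =
    {P. monic_prime P \<and> carlitz_order u P \<noteq> m \<and> (\<exists>k>0. m = carlitz_order u P * P ^ k)}"

lemma special_primes_subset: "special_primes u m \<subseteq> monic_primes_of m"
  by (auto simp: special_primes_def monic_primes_of_def)

text \<open>Each degree is a weighted sum of valuations, so the inversion can be done prime by
  prime: a Zsigmondy prime keeps its full multiplicity in \<open>C_m(u)\<close>, a special prime
  counts once, any other prime not at all.\<close>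

lemma degree_identity:
  fixes m u :: "'a::finite_field poly"
  assumes q: "CARD('a) > 2" and m: "lead_coeff m = 1" and u: "lead_coeff u = 1"
  shows "moebius_sum m (\<lambda>n. int (degree (carlitz_eval n u))) =
    (\<Sum>P | zsigmondy_prime u m P. int (degree P * pval P (carlitz_eval m u))) +
    (\<Sum>P\<in>special_primes u m. int (degree P))"
proof -
  let ?C = "\<lambda>n. carlitz_eval n u" and ?o = "carlitz_order u"
  define M where "M = {P. monic_prime P \<and> P dvd ?C m}"
  define V where "V P = moebius_sum m (\<lambda>n. int (pval P (?C n)))" for P
  have "m \<noteq> 0" using m by auto
  then have finM: "finite M"
    unfolding M_def by (intro finite_monic_prime_divisors carlitz_eval_neq_0[OF q u])
  have Z: "{P. zsigmondy_prime u m P} = {P \<in> M. ?o P = m}"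
    by (auto simp: M_def zsigmondy_prime_iff[OF m] dvd_carlitz_eval_iff)
  have Sp: "special_primes u m = {P \<in> M. ?o P \<noteq> m \<and> (\<exists>k>0. m = ?o P * P ^ k)}"
    by (auto simp: special_primes_def M_def dvd_carlitz_eval_iff)
  have deg: "int (degree (?C (m div \<Prod>B))) = (\<Sum>P\<in>M. int (degree P) * int (pval P (?C (m div \<Prod>B))))"
    if "B \<in> Pow (monic_primes_of m)" for B
  proof -
    have B: "B \<subseteq> monic_primes_of m" using that by simp
    have "m div \<Prod>B dvd m" using moebius_sum_div(3)[OF m B] by (metis dvd_triv_right)
    then have "?C (m div \<Prod>B) dvd ?C m" by (rule dvd_carlitz_eval)
    then have "degree (?C (m div \<Prod>B)) = (\<Sum>P\<in>M. degree P * pval P (?C (m div \<Prod>B)))"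
      using moebius_sum_div(2)[OF m B] finM
      by (intro degree_eq_sum_pval carlitz_eval_neq_0[OF q u]) (auto simp: M_def)
    then show ?thesis by simp
  qed
  have "moebius_sum m (\<lambda>n. int (degree (?C n))) = (\<Sum>B\<in>Pow (monic_primes_of m).
      \<Sum>P\<in>M. int (degree P) * ((- 1) ^ card B * int (pval P (?C (m div \<Prod>B)))))"
    unfolding moebius_sum_def
    by (rule sum.cong) (simp_all only: deg sum_distrib_left mult.left_commute)
  also have "\<dots> = (\<Sum>P\<in>M. int (degree P) * V P)"
    unfolding V_def moebius_sum_def sum_distrib_left by (rule sum.swap)
  also have "\<dots> = (\<Sum>P\<in>M. (if P \<in> {P. ?o P = m} then int (degree P * pval P (?C m)) else 0) +
      (if P \<in> {P. ?o P \<noteq> m \<and> (\<exists>k>0. m = ?o P * P ^ k)} then int (degree P) else 0))"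
  proof (rule sum.cong[OF refl])
    fix P assume "P \<in> M"
    then have "V P = (if ?o P = m then int (pval P (?C m)) else if \<exists>k>0. m = ?o P * P ^ k then 1 else 0)"
      unfolding V_def by (intro moebius_sum_pval[OF m q u]) (simp add: M_def)
    then show "int (degree P) * V P =
      (if P \<in> {P. ?o P = m} then int (degree P * pval P (?C m)) else 0) +
      (if P \<in> {P. ?o P \<noteq> m \<and> (\<exists>k>0. m = ?o P * P ^ k)} then int (degree P) else 0)"
      by (cases "?o P = m"; cases "\<exists>k>0. m = ?o P * P ^ k")
        (simp_all only: mem_Collect_eq if_True if_False simp_thms mult_0_right mult_1_right
          add_0_left add_0_right of_nat_mult)
  qed
  also have "\<dots> = (\<Sum>P | zsigmondy_prime u m P. int (degree P * pval P (?C m))) +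
      (\<Sum>P\<in>special_primes u m. int (degree P))"
    unfolding sum.distrib sum.inter_restrict[OF finM, symmetric] Z Sp
    by (simp add: Int_def)
  finally show ?thesis .
qed

text \<open>A Zsigmondy prime has degree at least \<open>degree m\<close>, so a large one, by its
  degree or by its multiplicity, alone exceeds \<open>degree m\<close>. If none is large,
  \<open>m + 1\<close> is the only candidate, with multiplicity at most 1 and degree at most
  \<open>degree m\<close>.\<close>

lemma exists_large_zsigmondy_prime_iff:
  fixes m u :: "'a::finite_field poly"
  assumes q: "CARD('a) > 2" and m: "lead_coeff m = 1" and u: "lead_coeff u = 1"
  shows "(\<exists>P. large_zsigmondy_prime u m P) \<longleftrightarrow>
    moebius_sum m (\<lambda>n. int (degree (carlitz_eval n u))) - (\<Sum>P\<in>special_primes u m. int (degree P))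
      > int (degree m)"
proof -
  let ?C = "carlitz_eval m u"
  define Z where "Z = {P. zsigmondy_prime u m P}"
  have "m \<noteq> 0" using m by auto
  then have C0: "?C \<noteq> 0" by (rule carlitz_eval_neq_0[OF q u])
  have finZ: "finite Z"
    by (rule finite_subset[OF _ finite_monic_prime_divisors[OF C0]]) (auto simp: Z_def zsigmondy_prime_def)
  have ZD: "monic_prime P" "m dvd P - 1" "lead_coeff (P - 1) = 1" "degree (P - 1) = degree P"
    "degree m \<le> degree P" "0 < degree P" "0 < pval P ?C" if "P \<in> Z" for P
  proof -
    have z: "zsigmondy_prime u m P" using that by (simp add: Z_def)
    then show P: "monic_prime P" by (simp add: zsigmondy_prime_def)
    then show D: "0 < degree P" by (rule monic_prime_degree_pos)
    show dvd: "m dvd P - 1"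
      using z carlitz_order_dvd_minus_1[OF P, of u] by (simp add: zsigmondy_prime_iff[OF m])
    show deg: "degree (P - 1) = degree P"
      using D degree_add_eq_left[of "- 1" P] by simp
    show "lead_coeff (P - 1) = 1" unfolding deg using D monic_primeD(4)[OF P] by simp
    show "degree m \<le> degree P"
      using dvd_imp_degree_le[OF dvd] deg D by fastforce
    show "0 < pval P ?C"
      using z pval_pos_iff[OF P C0] by (simp add: zsigmondy_prime_def)
  qed
  define N where "N = (\<Sum>P\<in>Z. degree P * pval P ?C)"
  have "(\<exists>P. large_zsigmondy_prime u m P) \<longleftrightarrow> N > degree m"
  proof
    assume "\<exists>P. large_zsigmondy_prime u m P"
    then obtain P where P: "P \<in> Z" and L: "degree P > degree m \<or> P ^ 2 dvd ?C"
      by (auto simp: large_zsigmondy_prime_def Z_def)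
    note PD = ZD[OF P]
    have "degree P * pval P ?C > degree m"
    proof (cases "degree P > degree m")
      case True
      moreover have "degree P * 1 \<le> degree P * pval P ?C" using PD by (intro mult_le_mono2) simp
      ultimately show ?thesis by linarith
    next
      case False
      then have "pval P ?C \<ge> 2" using L power_dvd_iff_le_pval[OF PD(1) C0] by auto
      then have "degree P * 2 \<le> degree P * pval P ?C" by (rule mult_le_mono2)
      then show ?thesis using PD by linarith
    qed
    also have "\<dots> \<le> N" unfolding N_def using P finZ by (intro member_le_sum) auto
    finally show "N > degree m" .
  next
    assume N: "N > degree m"
    show "\<exists>P. large_zsigmondy_prime u m P"
    proof (rule ccontr)
      assume nex: "\<nexists>P. large_zsigmondy_prime u m P"
      have small: "P = m + 1 \<and> degree P \<le> degree m \<and> pval P ?C \<le> 1" if P: "P \<in> Z" for P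
      proof -
        note PD = ZD[OF P]
        have "\<not> degree P > degree m" "\<not> P ^ 2 dvd ?C"
          using nex P by (auto simp: large_zsigmondy_prime_def Z_def)
        then have *: "degree P \<le> degree m" "pval P ?C \<le> 1"
          using power_dvd_iff_le_pval[OF PD(1) C0, of 2] by auto
        then have "m = P - 1" using PD m by (intro monic_dvd_antisym) auto
        then show ?thesis using * by simp
      qed
      have "N \<le> (\<Sum>P\<in>Z. degree m)" unfolding N_def
      proof (rule sum_mono)
        fix P assume "P \<in> Z"
        then have "degree P \<le> degree m" "pval P ?C \<le> 1" using small by blast+
        from mult_le_mono[OF this] show "degree P * pval P ?C \<le> degree m" by simp
      qed
      also have "\<dots> \<le> degree m"
      proof -
        have "Z \<subseteq> {m + 1}" using small by auto
        then have "card Z \<le> 1" using card_mono[of "{m + 1}" Z] by simp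
        then show ?thesis using mult_le_mono1[of "card Z" 1 "degree m"] by simp
      qed
      finally show False using N by simp
    qed
  qed
  moreover have "moebius_sum m (\<lambda>n. int (degree (carlitz_eval n u))) -
      (\<Sum>P\<in>special_primes u m. int (degree P)) = int N"
    using degree_identity[OF q m u] by (simp add: N_def Z_def)
  ultimately show ?thesis by (simp only: of_nat_less_iff)
qed

section \<open>Evaluating the Moebius sum\<close>

text \<open>Euler's function of \<open>A\<close>, the number of units modulo \<open>m\<close>, as an
  Euler product; real values avoid divisions in the integers.\<close>

definition totient_poly :: "'a::finite_field poly \<Rightarrow> real" where
  "totient_poly m = real CARD('a) ^ degree m *
    (\<Prod>R\<in>monic_primes_of m. 1 - 1 / real CARD('a) ^ degree R)"

text \<open>For monic \<open>m\<close>, being squarefree is expressed by equality with the product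
  of its prime divisors.\<close>

definition moebius_poly :: "'a::finite_field poly \<Rightarrow> int" where
  "moebius_poly m = (if \<Prod>(monic_primes_of m) = m then (- 1) ^ card (monic_primes_of m) else 0)"

lemma moebius_poly_le: "\<bar>moebius_poly m\<bar> \<le> 1"
  by (simp add: moebius_poly_def power_abs)

context
  fixes m :: "'a::finite_field poly"
  assumes m: "lead_coeff m = 1"
begin

lemma moebius_sum_cong:
  "(\<And>n. n \<noteq> 0 \<Longrightarrow> f n = g n) \<Longrightarrow> moebius_sum m f = moebius_sum m g"
  unfolding moebius_sum_def using moebius_sum_div(2)[OF m] by (intro sum.cong) auto

lemma moebius_sum_mult: "moebius_sum m (\<lambda>n. c * f n) = c * moebius_sum m f"
  by (simp add: moebius_sum_def sum_distrib_left mult.left_commute)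

lemma moebius_sum_diff: "moebius_sum m (\<lambda>n. f n - g n) = moebius_sum m f - moebius_sum m g"
  by (simp add: moebius_sum_def right_diff_distrib sum_subtractf)

lemma degree_prod_subset:
  assumes "B \<subseteq> monic_primes_of m"
  shows "degree (\<Prod>B) = (\<Sum>R\<in>B. degree R)" "degree (\<Prod>B) \<le> degree m"
proof -
  show "degree (\<Prod>B) = (\<Sum>R\<in>B. degree R)"
    using assms by (intro degree_prod_monic_primes) (auto simp: monic_primes_of_def)
  have "m \<noteq> 0" using m by auto
  then show "degree (\<Prod>B) \<le> degree m"
    using moebius_sum_subset(2)[OF m assms] by (intro dvd_imp_degree_le)
qed

lemma moebius_sum_card_power:
  "real_of_int (moebius_sum m (\<lambda>n. int (CARD('a) ^ degree n))) = totient_poly m"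
proof -
  let ?S = "monic_primes_of m" and ?q = "real CARD('a)"
  have fin: "finite ?S" using m by (intro finite_monic_primes_of) auto
  have *: "?q ^ degree (m div \<Prod>B) = ?q ^ degree m * (\<Prod>R\<in>B. 1 / ?q ^ degree R)"
    if "B \<in> Pow ?S" for B
  proof -
    have B: "B \<subseteq> ?S" using that by simp
    have "?q ^ degree (m div \<Prod>B) = ?q ^ degree m / ?q ^ degree (\<Prod>B)"
      unfolding moebius_sum_div(4)[OF m B]
      using degree_prod_subset(2)[OF B] by (simp add: power_diff)
    also have "?q ^ degree (\<Prod>B) = (\<Prod>R\<in>B. ?q ^ degree R)"
      unfolding degree_prod_subset(1)[OF B] by (rule power_sum)
    finally show ?thesis by (simp add: prod_dividef)
  qed
  have "real_of_int (moebius_sum m (\<lambda>n. int (CARD('a) ^ degree n))) =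
      (\<Sum>B\<in>Pow ?S. (- 1) ^ card B * ?q ^ degree (m div \<Prod>B))"
    by (simp add: moebius_sum_def)
  \<comment> \<open>The trivial product over \<open>?S - B\<close> gives the summand the shape of
    the subset expansion of the Euler product.\<close>
  also have "\<dots> = (\<Sum>B\<in>Pow ?S. ?q ^ degree m * ((- 1) ^ card B * (\<Prod>R\<in>B. 1 / ?q ^ degree R) * (\<Prod>R\<in>?S - B. 1)))"
    by (rule sum.cong) (simp_all add: *)
  also have "\<dots> = totient_poly m"
    unfolding totient_poly_def prod_diff_conv_sum[OF fin] sum_distrib_left ..
  finally show ?thesis .
qed

text \<open>The quotient \<open>m div \<Prod>B\<close> is constant only when \<open>\<Prod>B\<close>
  is all of \<open>m\<close>, which leaves the single term \<open>\<mu>(m)\<close>.\<close>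

lemma moebius_sum_one: "moebius_sum m (\<lambda>n. if degree n = 0 then 1 else 0) = moebius_poly m"
proof -
  let ?S = "monic_primes_of m"
  have fin: "finite ?S" using m by (intro finite_monic_primes_of) auto
  have deg0: "degree (m div \<Prod>B) = 0 \<longleftrightarrow> B = ?S \<and> \<Prod>?S = m" if "B \<in> Pow ?S" for B
  proof
    have B: "B \<subseteq> ?S" using that by simp
    assume "degree (m div \<Prod>B) = 0"
    then have "m div \<Prod>B = 1" using moebius_sum_div(1)[OF m B] by (intro monic_degree_0)
    then have eq: "m = \<Prod>B" using moebius_sum_div(3)[OF m B] by simp
    have "R \<in> B" if "R \<in> ?S" for R
      using that B moebius_sum_subset(1)[OF m B] monic_prime_dvd_prod_iff[of B R]
      by (subst (asm) eq) (auto simp: monic_primes_of_def)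
    with B have "B = ?S" by blast
    with eq show "B = ?S \<and> \<Prod>?S = m" by simp
  next
    assume "B = ?S \<and> \<Prod>?S = m"
    moreover have "m \<noteq> 0" using m by auto
    ultimately show "degree (m div \<Prod>B) = 0" by simp
  qed
  have "moebius_sum m (\<lambda>n. if degree n = 0 then 1 else 0) =
      (\<Sum>B\<in>Pow ?S. if B = ?S then (if \<Prod>?S = m then (- 1) ^ card B else 0) else 0)"
    unfolding moebius_sum_def by (rule sum.cong) (auto simp: deg0)
  also have "\<dots> = moebius_poly m" using fin by (simp add: moebius_poly_def)
  finally show ?thesis .
qed

lemma moebius_sum_degree:
  assumes q: "CARD('a) > 2" and u: "degree u > 0"
  shows "real_of_int (moebius_sum m (\<lambda>n. int (degree (carlitz_eval n u)))) =
    real (degree u) * totient_poly m"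
proof -
  have "moebius_sum m (\<lambda>n. int (degree (carlitz_eval n u))) =
      moebius_sum m (\<lambda>n. int (degree u) * int (CARD('a) ^ degree n))"
    by (rule moebius_sum_cong) (simp add: degree_carlitz_eval_of_degree_pos[OF q u])
  then show ?thesis
    by (simp only: moebius_sum_mult moebius_sum_card_power of_int_mult of_int_of_nat_eq)
qed

text \<open>\<open>q\<close> times the degree of \<open>C_n(1)\<close> is
  \<open>q ^ degree n\<close>, less 1 for constant \<open>n\<close>; the two parts invert to
  \<open>\<phi>(m)\<close> and \<open>\<mu>(m)\<close>.\<close>

lemma moebius_sum_degree_1:
  assumes q: "CARD('a) > 2"
  shows "real CARD('a) * real_of_int (moebius_sum m (\<lambda>n. int (degree (carlitz_eval n 1)))) =
    totient_poly m - real_of_int (moebius_poly m)"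
proof -
  have "int CARD('a) * moebius_sum m (\<lambda>n. int (degree (carlitz_eval n 1))) =
      moebius_sum m (\<lambda>n. int CARD('a) * int (degree (carlitz_eval n 1)))"
    by (simp add: moebius_sum_mult)
  also have "\<dots> = moebius_sum m (\<lambda>n. int (CARD('a) ^ degree n) - (if degree n = 0 then 1 else 0))"
  proof (rule moebius_sum_cong)
    fix n :: "'a poly" assume "n \<noteq> 0"
    show "int CARD('a) * int (degree (carlitz_eval n 1)) =
        int (CARD('a) ^ degree n) - (if degree n = 0 then 1 else 0)"
      unfolding degree_carlitz_eval_1[OF q \<open>n \<noteq> 0\<close>] by (cases "degree n") auto
  qed
  finally have "int CARD('a) * moebius_sum m (\<lambda>n. int (degree (carlitz_eval n 1))) =
      moebius_sum m (\<lambda>n. int (CARD('a) ^ degree n)) - moebius_poly m"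
    by (simp only: moebius_sum_diff moebius_sum_one)
  then have "real_of_int (int CARD('a) * moebius_sum m (\<lambda>n. int (degree (carlitz_eval n 1)))) =
      real_of_int (moebius_sum m (\<lambda>n. int (CARD('a) ^ degree n)) - moebius_poly m)"
    by (rule arg_cong)
  then show ?thesis
    by (simp only: of_int_diff of_int_mult of_int_of_nat_eq moebius_sum_card_power)
qed

text \<open>Each Euler factor is at least \<open>1 - 1 / q\<close>, hence at least
  \<open>(1 - 1 / q) ^ degree R\<close>, and the degrees of the distinct prime divisors add up to at
  most \<open>degree m\<close>.\<close>

lemma totient_poly_ge: "(real CARD('a) - 1) ^ degree m \<le> totient_poly m"
proof -
  let ?S = "monic_primes_of m" and ?q = "real CARD('a)"
  have q: "?q \<ge> 2" using card_finite_field_ge_2[where 'a = 'a] by simp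
  let ?x = "1 - 1 / ?q"
  have x: "0 \<le> ?x" "?x \<le> 1" using q by auto
  have "?x ^ degree m \<le> ?x ^ degree (\<Prod>?S)"
    using x degree_prod_subset(2)[of ?S] by (intro power_decreasing) auto
  also have "\<dots> = (\<Prod>R\<in>?S. ?x ^ degree R)"
    unfolding degree_prod_subset(1)[OF order.refl] by (rule power_sum)
  also have "\<dots> \<le> (\<Prod>R\<in>?S. 1 - 1 / ?q ^ degree R)"
  proof (rule prod_mono)
    fix R assume "R \<in> ?S"
    then have "degree R > 0" by (simp add: monic_primes_of_def monic_prime_degree_pos)
    then have "?x ^ degree R \<le> ?x ^ 1" "?q ^ 1 \<le> ?q ^ degree R"
      using x q by (intro power_decreasing power_increasing; simp)+
    then have "?x ^ degree R \<le> ?x" "1 / ?q ^ degree R \<le> 1 / ?q"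
      using q by (auto intro: divide_left_mono)
    then show "0 \<le> ?x ^ degree R \<and> ?x ^ degree R \<le> 1 - 1 / ?q ^ degree R" using x by auto
  qed
  finally have "?q ^ degree m * ?x ^ degree m \<le> totient_poly m"
    unfolding totient_poly_def by (rule mult_left_mono) simp
  moreover have "?q ^ degree m * ?x ^ degree m = (?q - 1) ^ degree m"
    using q by (simp add: power_mult_distrib[symmetric] right_diff_distrib)
  ultimately show ?thesis by simp
qed

lemma sum_degree_special_le:
  "(\<Sum>P\<in>special_primes u m. int (degree P)) \<le> int (degree m)"
proof -
  have "(\<Sum>P\<in>special_primes u m. degree P) \<le> degree m"
    using degree_prod_subset[OF special_primes_subset] by simp
  then show ?thesis by (simp flip: of_nat_sum)
qed

text \<open>Since \<open>C_1(1) = 1\<close> is a unit, the order of 1 is nonconstant, and it divides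
  \<open>P - 1\<close>. If it is linear, the value annihilated by \<open>P\<close> has degree 1, so
  \<open>P\<close> is linear and the order must be \<open>P - 1\<close>.\<close>

lemma special_primes_1:
  assumes q: "CARD('a) > 2" and P: "P \<in> special_primes 1 m"
  obtains n k where "k > 0" "m = n * P ^ k" "lead_coeff n = 1" "0 < degree n" "degree n \<le> degree P"
    "degree n = 1 \<Longrightarrow> degree P = 1 \<and> n = P - 1"
proof -
  let ?n = "carlitz_order 1 P"
  have PP: "monic_prime P" using P by (simp add: special_primes_def)
  obtain k where k: "k > 0" "m = ?n * P ^ k" using P by (auto simp: special_primes_def)
  have l: "lead_coeff ?n = 1" by (rule lead_coeff_carlitz_order[OF PP])
  have D: "degree P > 0" by (rule monic_prime_degree_pos[OF PP])
  have P1: "degree (P - 1) = degree P" "P - 1 \<noteq> 0" "lead_coeff (P - 1) = 1"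
    using D degree_add_eq_left[of "- 1" P] monic_primeD(4)[OF PP] by auto
  have dvd: "P dvd carlitz_eval ?n 1" by (simp add: dvd_carlitz_eval_iff[OF PP])
  have "?n \<noteq> 1" using dvd monic_primeD(3)[OF PP] by auto
  then have n: "degree ?n > 0" using monic_degree_0[OF l] by auto
  have le: "degree ?n \<le> degree P"
    using dvd_imp_degree_le[OF carlitz_order_dvd_minus_1[OF PP] P1(2)] P1 by simp
  have "degree P = 1 \<and> ?n = P - 1" if "degree ?n = 1"
  proof -
    have "?n \<noteq> 0" using l by auto
    then have "degree (carlitz_eval ?n 1) = 1" using degree_carlitz_eval_1[OF q, of ?n] that by simp
    moreover from this have "carlitz_eval ?n 1 \<noteq> 0" by auto
    ultimately have "degree P = 1" using dvd_imp_degree_le[OF dvd] D by simp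
    then show ?thesis
      using that P1 l carlitz_order_dvd_minus_1[OF PP, of 1] by (auto intro: monic_dvd_antisym)
  qed
  with that k l n le show ?thesis by blast
qed

end

lemma special_primesI:
  fixes P :: "'a::finite_field poly"
  assumes q: "CARD('a) > 2" and P: "monic_prime P" "degree P = 1" and k: "k > 0"
  shows "P \<in> special_primes 1 ((P - 1) * P ^ k)"
proof -
  let ?n = "carlitz_order 1 P"
  have l: "lead_coeff ?n = 1" by (rule lead_coeff_carlitz_order[OF P(1)])
  have P1: "degree (P - 1) = 1" "P - 1 \<noteq> 0" "lead_coeff (P - 1) = 1"
    using P degree_add_eq_left[of "- 1" P] monic_primeD(4)[OF P(1)] by auto
  have "?n \<noteq> 1"
    using dvd_carlitz_eval_iff[OF P(1), of 1 ?n] monic_primeD(3)[OF P(1)] by auto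
  then have "degree ?n > 0" using monic_degree_0[OF l] by auto
  then have n: "?n = P - 1"
    using P1 l carlitz_order_dvd_minus_1[OF P(1), of 1] by (auto intro: monic_dvd_antisym)
  have "P - 1 \<noteq> (P - 1) * P ^ k"
  proof
    assume "P - 1 = (P - 1) * P ^ k"
    then have "P ^ k = 1" using P1 by simp
    then show False using k monic_primeD(3)[OF P(1)] by (metis dvd_power)
  qed
  then show ?thesis using P k by (auto simp: special_primes_def n)
qed

text \<open>For two special primes \<open>P\<close> and \<open>R\<close>, each divides
  \<open>m\<close> and hence the order belonging to the other, so \<open>R\<close> divides
  \<open>P - 1\<close> and \<open>P\<close> divides \<open>R - 1\<close>. Both quotients are
  constant, so \<open>R = P - 1\<close> and \<open>P = R - 1\<close>, whence
  \<open>2 = 0\<close>.\<close>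

lemma special_primes_unique:
  fixes u m :: "'a::finite_field poly"
  assumes two: "(2 :: 'a) \<noteq> 0" and P: "P \<in> special_primes u m" and R: "R \<in> special_primes u m"
  shows "P = R"
proof (rule ccontr)
  assume "P \<noteq> R"
  have *: "Q' dvd Q - 1" if "Q \<in> special_primes u m" "Q' \<in> special_primes u m" "Q' \<noteq> Q" for Q Q'
  proof -
    note Qs = that
    have Q: "monic_prime Q" "monic_prime Q'" using that by (auto simp: special_primes_def)
    have "Q' dvd m" using special_primes_subset that by (auto simp: monic_primes_of_def)
    moreover obtain k where "m = carlitz_order u Q * Q ^ k" using Qs(1) unfolding special_primes_def by blast
    ultimately have "Q' dvd carlitz_order u Q"
      using Q that(3) prime_elem_dvd_power[of Q' Q k]
      by (auto simp: prime_elem_dvd_mult_iff monic_primeD monic_prime_dvd_iff_eq)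
    then show ?thesis using carlitz_order_dvd_minus_1[OF Q(1)] dvd_trans by blast
  qed
  have M: "monic_prime P" "monic_prime R" using P R by (auto simp: special_primes_def)
  have m1: "degree (Q - 1) = degree Q \<and> Q - 1 \<noteq> 0 \<and> lead_coeff (Q - 1) = 1" if "monic_prime Q" for Q :: "'a poly"
    using monic_prime_degree_pos[OF that] degree_add_eq_left[of "- 1" Q] monic_primeD(4)[OF that] by auto
  have "R dvd P - 1" "P dvd R - 1" using * P R \<open>P \<noteq> R\<close> by auto
  moreover from this have "degree R \<le> degree P" "degree P \<le> degree R"
    using m1 M by (metis dvd_imp_degree_le)+
  ultimately have "R = P - 1" "P = R - 1"
    using m1[OF M(1)] m1[OF M(2)] monic_primeD(4)[OF M(1)] monic_primeD(4)[OF M(2)]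
    by (auto intro!: monic_dvd_antisym)
  then have "(R - (P - 1)) + (P - (R - 1)) = 0" by (simp only: diff_self add_0_left)
  then have "(2 :: 'a poly) = 0" by simp
  then have "[:2 :: 'a:] = 0" by (simp only: numeral_poly)
  then show False using two by simp
qed

lemma monic_primes_of_prime: "monic_prime R \<Longrightarrow> monic_primes_of R = {R}"
  by (auto simp: monic_primes_of_def monic_prime_dvd_iff_eq)

lemma monic_primes_of_mult: "monic_primes_of (a * b) = monic_primes_of a \<union> monic_primes_of b"
  by (auto simp: monic_primes_of_def prime_elem_dvd_mult_iff monic_primeD)

lemma degree_1_monic:
  assumes "degree R = 1" "lead_coeff R = 1"
  shows "R = [:coeff R 0, 1:]"
proof (rule poly_eqI)
  fix n show "coeff R n = coeff [:coeff R 0, 1:] n"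
    using assms by (cases n; cases "n - 1") (auto simp: coeff_eq_0)
qed

lemma monic_prime_linear: "monic_prime [:c, 1:]" for c :: "'a::finite_field"
  by (simp add: monic_prime_def prime_elem_linear_field_poly)

lemma monic_prime_of_degree_1:
  "degree R = 1 \<Longrightarrow> lead_coeff R = 1 \<Longrightarrow> monic_prime R" for R :: "'a::finite_field poly"
  by (metis degree_1_monic monic_prime_linear)

section \<open>Degrees contributed by Zsigmondy primes\<close>

text \<open>By \<open>degree_identity\<close> this is the degree, with multiplicity, of the part of
  \<open>C_m(u)\<close> composed of Zsigmondy primes.\<close>

definition zsigmondy_degree :: "'a::finite_field poly \<Rightarrow> 'a poly \<Rightarrow> int" where
  "zsigmondy_degree u m = moebius_sum m (\<lambda>n. int (degree (carlitz_eval n u))) -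
    (\<Sum>P\<in>special_primes u m. int (degree P))"

context
  fixes m :: "'a::finite_field poly"
  assumes q: "CARD('a) > 2" and m: "lead_coeff m = 1"
begin

lemma large_zsigmondy_iff:
  "lead_coeff u = 1 \<Longrightarrow> (\<exists>P. large_zsigmondy_prime u m P) \<longleftrightarrow> zsigmondy_degree u m > int (degree m)"
  unfolding zsigmondy_degree_def by (rule exists_large_zsigmondy_prime_iff[OF q m])

lemma zsigmondy_degree_le:
  "zsigmondy_degree u m \<le> moebius_sum m (\<lambda>n. int (degree (carlitz_eval n u)))"
  unfolding zsigmondy_degree_def by (simp add: sum_nonneg)

lemma zsigmondy_degree_ge:
  "zsigmondy_degree u m \<ge> moebius_sum m (\<lambda>n. int (degree (carlitz_eval n u))) - int (degree m)"
  unfolding zsigmondy_degree_def using sum_degree_special_le[OF m, of u] by simp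

lemma zsigmondy_degree_no_special:
  "special_primes u m = {} \<Longrightarrow> zsigmondy_degree u m = moebius_sum m (\<lambda>n. int (degree (carlitz_eval n u)))"
  by (simp add: zsigmondy_degree_def)

lemma zsigmondy_degree_special:
  assumes "P \<in> special_primes u m"
  shows "zsigmondy_degree u m \<le>
    moebius_sum m (\<lambda>n. int (degree (carlitz_eval n u))) - int (degree P)"
proof -
  have "finite (special_primes u m)"
    using finite_monic_primes_of[of m] finite_subset[OF special_primes_subset] m by fastforce
  then have "int (degree P) \<le> (\<Sum>P\<in>special_primes u m. int (degree P))"
    using assms by (intro member_le_sum) auto
  then show ?thesis by (simp add: zsigmondy_degree_def)
qed

lemma moebius_sum_degree_1_eq:
  assumes "totient_poly m - real_of_int (moebius_poly m) = real CARD('a) * real_of_int d"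
  shows "moebius_sum m (\<lambda>n. int (degree (carlitz_eval n 1))) = d"
proof -
  have "real CARD('a) * real_of_int (moebius_sum m (\<lambda>n. int (degree (carlitz_eval n 1)))) =
      real CARD('a) * real_of_int d"
    unfolding moebius_sum_degree_1[OF m q] by (rule assms)
  then show ?thesis by simp
qed

lemma moebius_sum_degree_1_gr:
  assumes "totient_poly m - real_of_int (moebius_poly m) > real CARD('a) * real_of_int d"
  shows "moebius_sum m (\<lambda>n. int (degree (carlitz_eval n 1))) > d"
proof -
  have "real CARD('a) * real_of_int (moebius_sum m (\<lambda>n. int (degree (carlitz_eval n 1)))) >
      real CARD('a) * real_of_int d"
    unfolding moebius_sum_degree_1[OF m q] by (rule assms)
  then show ?thesis by simp
qed

text \<open>Here \<open>\<phi>(m) = q ^ degree m - 1\<close> and \<open>\<mu>(m) = -1\<close>, so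
  the numerator is exactly \<open>q ^ degree m\<close>.\<close>

lemma moebius_sum_degree_1_prime:
  assumes "monic_prime m"
  shows "moebius_sum m (\<lambda>n. int (degree (carlitz_eval n 1))) = int CARD('a) ^ (degree m - 1)"
proof (rule moebius_sum_degree_1_eq)
  obtain k where "degree m = Suc k" using monic_prime_degree_pos[OF assms] gr0_implies_Suc by blast
  then show "totient_poly m - real_of_int (moebius_poly m) =
      real CARD('a) * real_of_int (int CARD('a) ^ (degree m - 1))"
    by (simp add: totient_poly_def moebius_poly_def monic_primes_of_prime[OF assms] right_diff_distrib)
qed

text \<open>One \<open>degree m\<close> is the target and another bounds the special primes, so
  \<open>\<phi>(m) - \<mu>(m) > 2 q e\<close> suffices; with \<open>r = q - 1\<close> it follows
  from \<open>r ^ e > 2 e (r + 1) + 1\<close>. For \<open>r = 2\<close> this holds from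
  \<open>e = 5\<close> on, barely, by \<open>32 > 31\<close>; for \<open>r \<ge> 3\<close> it holds
  from \<open>e = 3\<close> on.\<close>

lemma large_zsigmondy_of_large:
  assumes "(3 \<le> degree m \<and> 3 < CARD('a)) \<or> 5 \<le> degree m"
  shows "zsigmondy_degree 1 m > int (degree m)"
proof -
  define e where "e = degree m"
  define r where "r = CARD('a) - 1"
  have qr: "CARD('a) = r + 1" "r \<ge> 2" using q by (auto simp: r_def)
  have grow: "2 * Suc n * (r + 1) + 1 < r ^ Suc n" if "2 * n * (r + 1) + 1 < r ^ n" "n > 0" for n
  proof -
    have "2 * Suc n * (r + 1) + 1 \<le> 2 * (2 * n * (r + 1) + 1)"
    proof -
      have "1 * (r + 1) \<le> n * (r + 1)" using that by (intro mult_le_mono1) simp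
      then show ?thesis by (simp add: algebra_simps)
    qed
    also have "\<dots> \<le> r * (2 * n * (r + 1) + 1)" using qr by (intro mult_le_mono1)
    also have "\<dots> < r * r ^ n" using that qr by (intro mult_strict_left_mono) auto
    finally show ?thesis by simp
  qed
  have "2 * e * (r + 1) + 1 < r ^ e"
  proof (cases "r = 2")
    case True
    then have "5 \<le> e" using assms qr by (auto simp: e_def)
    then show ?thesis
    proof (induction e rule: dec_induct)
      case base
      then show ?case using True by simp
    next
      case (step n)
      then show ?case using grow[of n] by simp
    qed
  next
    case False
    then have "3 \<le> r" "3 \<le> e" using assms qr by (auto simp: e_def)
    from \<open>3 \<le> e\<close> show ?thesis
    proof (induction e rule: dec_induct)
      case base
      have "9 * r \<le> r ^ 3" using \<open>3 \<le> r\<close> mult_le_mono[of 3 r 3 r]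
        by (simp add: power3_eq_cube mult_le_mono1)
      then show ?case using \<open>3 \<le> r\<close> by simp
    next
      case (step n)
      then show ?case using grow[of n] by simp
    qed
  qed
  then have "real (2 * e * (r + 1) + 1) < real (r ^ e)" by (simp only: of_nat_less_iff)
  also have "\<dots> \<le> totient_poly m" using totient_poly_ge[OF m] by (simp add: e_def qr)
  finally have "real CARD('a) * real_of_int (int (2 * e)) < totient_poly m - real_of_int (moebius_poly m)"
    using moebius_poly_le[of m] unfolding qr by (simp add: algebra_simps)
  from moebius_sum_degree_1_gr[OF this] zsigmondy_degree_ge[of 1] show ?thesis
    by (simp add: e_def)
qed

text \<open>For \<open>q = 3\<close> and degrees 3 and 4 the bound \<open>2 ^ degree m\<close> is
  too weak. There are only three linear primes, each with Euler factor \<open>2 / 3\<close>; the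
  \<open>b\<close> other prime divisors have degree at least 2 and factor at least
  \<open>8 / 9\<close>.\<close>

lemma totient_poly_ge_card_3:
  assumes q3: "CARD('a) = 3"
  defines "L \<equiv> {R \<in> monic_primes_of m. degree R = 1}"
  obtains b where "card L \<le> 3" "card L + 2 * b \<le> degree m"
    "3 ^ degree m * (2 / 3) ^ card L * (8 / 9) ^ b \<le> totient_poly m"
    "b = 0 \<Longrightarrow> monic_primes_of m = L"
proof -
  let ?S = "monic_primes_of m"
  define N where "N = ?S - L"
  have fin: "finite ?S" using m by (intro finite_monic_primes_of) auto
  have S: "?S = L \<union> N" "L \<inter> N = {}" "finite L" "finite N"
    using fin by (auto simp: L_def N_def)
  have deg2: "degree R \<ge> 2" if "R \<in> N" for R
    using that monic_prime_degree_pos[of R] by (auto simp: N_def L_def monic_primes_of_def)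
  have "inj_on (\<lambda>R. coeff R 0) L"
    by (rule inj_onI) (metis (mono_tags, lifting) L_def degree_1_monic mem_Collect_eq monic_primeD(4) monic_primes_of_def)
  then have 1: "card L \<le> 3"
    using card_inj_on_le[of "\<lambda>R. coeff R 0" L UNIV] q3 by simp
  have "(\<Sum>R\<in>?S. degree R) \<le> degree m" using degree_prod_subset[OF m order.refl] by simp
  moreover have "(\<Sum>R\<in>?S. degree R) = (\<Sum>R\<in>L. degree R) + (\<Sum>R\<in>N. degree R)"
    unfolding S(1) by (rule sum.union_disjoint) (use S in auto)
  moreover have "(\<Sum>R\<in>L. degree R) = card L" by (simp add: L_def)
  moreover have "(\<Sum>R\<in>N. 2) \<le> (\<Sum>R\<in>N. degree R)" by (rule sum_mono) (rule deg2)
  ultimately have 2: "card L + 2 * card N \<le> degree m" by simp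
  have "(\<Prod>R\<in>?S. 1 - 1 / (3::real) ^ degree R) =
      (\<Prod>R\<in>L. 1 - 1 / 3 ^ degree R) * (\<Prod>R\<in>N. 1 - 1 / 3 ^ degree R)"
    unfolding S(1) by (rule prod.union_disjoint) (use S in auto)
  moreover have "(\<Prod>R\<in>L. 1 - 1 / (3::real) ^ degree R) = (2 / 3) ^ card L"
    by (simp add: L_def)
  moreover have "(\<Prod>R\<in>N. 8 / 9) \<le> (\<Prod>R\<in>N. 1 - 1 / (3::real) ^ degree R)"
  proof (rule prod_mono)
    fix R assume "R \<in> N"
    then have "(3::real) ^ 2 \<le> 3 ^ degree R" using deg2 by (intro power_increasing) auto
    then have "1 / (3::real) ^ degree R \<le> 1 / 9" by (intro divide_left_mono) auto
    then show "0 \<le> (8 / 9 :: real) \<and> 8 / 9 \<le> 1 - 1 / (3::real) ^ degree R" by simp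
  qed
  ultimately have "(2 / 3) ^ card L * (8 / 9) ^ card N \<le> (\<Prod>R\<in>?S. 1 - 1 / (3::real) ^ degree R)"
    by simp
  then have 3: "3 ^ degree m * (2 / 3) ^ card L * (8 / 9) ^ card N \<le> totient_poly m"
    by (simp add: totient_poly_def q3 mult.assoc mult_left_mono)
  have 4: "?S = L" if "card N = 0" using that S by auto
  show ?thesis by (rule that[OF 1 2 3 4])
qed

lemma large_zsigmondy_card_3_degree_4:
  assumes q3: "CARD('a) = 3" and e: "degree m = 4"
  shows "zsigmondy_degree 1 m > int (degree m)"
proof -
  define L where "L = {R \<in> monic_primes_of m. degree R = 1}"
  obtain b where b: "card L \<le> 3" "card L + 2 * b \<le> 4"
    "3 ^ 4 * (2 / 3) ^ card L * (8 / 9) ^ b \<le> totient_poly m"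
    "b = 0 \<Longrightarrow> monic_primes_of m = L"
    using totient_poly_ge_card_3[OF q3] unfolding e L_def by blast
  show ?thesis
  proof (cases "card L = 3")
    case True
    then have "b = 0" using b by simp
    then have S: "monic_primes_of m = L" by (rule b(4))
    \<comment> \<open>Three linear primes and no other prime in degree 4 force a repeated factor, so
      \<open>\<mu>(m) = 0\<close>. The Moebius sum is then at least \<open>24 / 3 = 8\<close>, and
      special primes take at most 3 of it.\<close>
    have tot: "24 \<le> totient_poly m" using b(3) True \<open>b = 0\<close> by (simp add: power3_eq_cube power_divide)
    have "(\<Sum>R\<in>L. degree R) = 3" using True by (simp add: L_def)
    then have dS: "degree (\<Prod>(monic_primes_of m)) = 3"
      using degree_prod_subset(1)[OF m order.refl] S by simp
    then have "moebius_poly m = 0" using e by (auto simp: moebius_poly_def)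
    then have "moebius_sum m (\<lambda>n. int (degree (carlitz_eval n 1))) > 7"
      using tot by (intro moebius_sum_degree_1_gr) (simp add: q3)
    moreover have "(\<Sum>P\<in>special_primes 1 m. degree P) \<le> (\<Sum>P\<in>L. degree P)"
    proof (rule sum_mono2)
      have "m \<noteq> 0" using m by auto
      then show "finite L" using finite_monic_primes_of S by metis
      show "special_primes 1 m \<subseteq> L" using special_primes_subset S by metis
    qed simp
    then have "(\<Sum>P\<in>special_primes 1 m. int (degree P)) \<le> 3"
      using \<open>(\<Sum>R\<in>L. degree R) = 3\<close> by (simp flip: of_nat_sum)
    ultimately show ?thesis by (simp add: zsigmondy_degree_def e)
  next
    case False
    define a where "a = card L"
    have "a = 0 \<or> a = 1 \<or> a = 2" "b = 0 \<or> b = 1 \<or> b = 2" "a + 2 * b \<le> 4"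
      using b False unfolding a_def by linarith+
    \<comment> \<open>The target is \<open>\<phi>(m) - \<mu>(m) > 24 = 3 * 8\<close>, where
      \<open>8 = 2 * degree m\<close>. The least value occurring is 32, at \<open>a = 2\<close> and
      \<open>b = 1\<close>.\<close>
    then have "26 \<le> 3 ^ 4 * (2 / 3 :: real) ^ a * (8 / 9) ^ b"
      by (elim disjE) (simp_all add: power2_eq_square)
    then have "26 \<le> totient_poly m" using b(3) unfolding a_def by linarith
    then have "moebius_sum m (\<lambda>n. int (degree (carlitz_eval n 1))) > 8"
      using moebius_poly_le[of m] by (intro moebius_sum_degree_1_gr) (simp add: q3)
    then show ?thesis using zsigmondy_degree_ge[of 1] e by simp
  qed
qed

text \<open>The Moebius sum is at least \<open>(q - 1) ^ e\<close>, which exceeds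
  \<open>2 * e\<close> for positive \<open>e\<close> unless \<open>q = 3\<close> and
  \<open>e\<close> is 1 or 2. These two cases need the special primes themselves.\<close>

lemma large_zsigmondy_u_nonconst:
  assumes u: "lead_coeff u = 1" and d: "degree u > 0"
  shows "zsigmondy_degree u m > int (degree m) \<longleftrightarrow> \<not> (CARD('a) = 3 \<and> u = m \<and> degree m = 1)"
proof -
  define e where "e = degree m"
  define D where "D = moebius_sum m (\<lambda>n. int (degree (carlitz_eval n u)))"
  have D: "real_of_int D = real (degree u) * totient_poly m"
    unfolding D_def by (rule moebius_sum_degree[OF m q d])
  define t where "t = totient_poly m"
  have "0 \<le> t" using totient_poly_ge[OF m] q unfolding t_def by (meson diff_ge_0_iff_ge less_imp_le
        numeral_le_real_of_nat_iff order_trans one_le_numeral of_nat_1 zero_le_power)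
  then have Dt: "real_of_int D \<ge> t" using d D mult_right_mono[of 1 "real (degree u)" t] by (simp add: t_def)
  have t: "(real CARD('a) - 1) ^ e \<le> t" unfolding e_def t_def by (rule totient_poly_ge[OF m])
  have zge: "zsigmondy_degree u m \<ge> D - int e" using zsigmondy_degree_ge unfolding D_def e_def .
  consider "e = 0" | "e > 0" "CARD('a) > 3" | "e \<ge> 3" "CARD('a) = 3"
    | "e = 2" "CARD('a) = 3" | "e = 1" "CARD('a) = 3"
    using q by linarith
  then show ?thesis
  proof cases
    case 1
    then have "D \<ge> 1" using t Dt by simp
    then show ?thesis using zge 1 by (simp add: e_def)
  next
    case 2
    have "2 * n < 3 ^ n" for n :: nat
      by (induction n) auto
    then have "real (2 * e) < real (3 ^ e)" by (simp only: of_nat_less_iff)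
    also have "\<dots> \<le> (real CARD('a) - 1) ^ e" using 2 by (simp add: power_mono)
    finally have "real_of_int (int (2 * e)) < real_of_int D" using t Dt by simp
    then have "int (2 * e) < D" by (simp only: of_int_less_iff)
    then show ?thesis using zge 2 by (simp add: e_def)
  next
    case 3
    from \<open>e \<ge> 3\<close> have "2 * e < 2 ^ e"
      by (induction e rule: dec_induct) auto
    then have "real (2 * e) < real (2 ^ e)" by (simp only: of_nat_less_iff)
    then have "real_of_int (int (2 * e)) < real_of_int D" using t Dt 3 by simp
    then have "int (2 * e) < D" by (simp only: of_int_less_iff)
    then show ?thesis using zge 3 by (simp add: e_def)
  next
    case 4
    have two: "(2 :: 'a) \<noteq> 0"
    proof
      assume "(2 :: 'a) = 0"
      moreover have "(of_nat 3 :: 'a) = 0"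
        using of_nat_binomial_card_eq_0[of 1, where 'a = 'a] 4 by simp
      then have "(2 :: 'a) + 1 = 0" by simp
      ultimately show False by simp
    qed
    \<comment> \<open>This only equals \<open>2 * e\<close>, but at most one special prime exists
      because \<open>2 \<noteq> 0\<close>. If linear it leaves at least 3; if quadratic it is
      \<open>m\<close> itself, and then \<open>\<phi>(m) = 8\<close>.\<close>
    have "D \<ge> 4" using t Dt 4 by simp
    have "zsigmondy_degree u m > 2"
    proof (cases "special_primes u m = {}")
      case True
      then show ?thesis using \<open>D \<ge> 4\<close> zsigmondy_degree_no_special[OF True] by (simp add: D_def)
    next
      case False
      then obtain P where P: "P \<in> special_primes u m" by auto
      then have "special_primes u m = {P}" using special_primes_unique[OF two] by blast
      then have z: "zsigmondy_degree u m = D - int (degree P)"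
        by (simp add: zsigmondy_degree_def D_def)
      have PP: "monic_prime P" "P dvd m"
        using P special_primes_subset by (auto simp: monic_primes_of_def)
      have "m \<noteq> 0" using m by auto
      then have "degree P \<le> 2" using PP 4 dvd_imp_degree_le unfolding e_def by metis
      show ?thesis
      proof (cases "degree P = 2")
        case True
        then have "m = P"
          using monic_dvd_antisym[OF monic_primeD(4)[OF PP(1)] m PP(2)] 4 by (simp add: e_def)
        then have "t = 8"
          using monic_primes_of_prime[OF PP(1)] True 4 by (simp add: t_def totient_poly_def)
        then show ?thesis using Dt z True by linarith
      next
        case False
        then show ?thesis using \<open>degree P \<le> 2\<close> z \<open>D \<ge> 4\<close> by linarith
      qed
    qed
    then show ?thesis using 4 by (simp add: e_def)
  next
    case 5
    have M: "monic_prime m" using 5 m by (intro monic_prime_of_degree_1) (auto simp: e_def)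
    have "t = 2" using monic_primes_of_prime[OF M] 5 by (simp add: t_def totient_poly_def e_def)
    then have "real_of_int D = real_of_int (2 * int (degree u))" using D by (simp add: t_def)
    then have D2: "D = 2 * int (degree u)" by (simp only: of_int_eq_iff)
    show ?thesis
    proof (cases "u = m")
      case True
      \<comment> \<open>\<open>C_1(m) = m\<close> vanishes modulo \<open>m\<close>, so the order is
        1 and \<open>m\<close> is itself special, leaving \<open>2 - 1 = 1\<close>.\<close>
      have "carlitz_order m m dvd 1" by (simp flip: dvd_carlitz_eval_iff[OF M])
      moreover have "carlitz_order m m \<noteq> 0"
        using lead_coeff_carlitz_order[OF M, of m] by auto
      ultimately have "carlitz_order m m = 1"
        using lead_coeff_carlitz_order[OF M, of m]
        by (intro monic_degree_0) (simp_all add: is_unit_iff_degree)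
      moreover have "1 \<noteq> m" "m = 1 * m ^ 1" using monic_primeD(3)[OF M] by auto
      ultimately have "m \<in> special_primes m m"
        unfolding special_primes_def using M zero_less_one by (metis (mono_tags, lifting) mem_Collect_eq)
      then have "zsigmondy_degree u m \<le> 1"
        using zsigmondy_degree_special[of m m] D2 5 True by (simp add: D_def e_def)
      then show ?thesis using True 5 by (simp add: e_def)
    next
      case False
      have "zsigmondy_degree u m > 1"
      proof (cases "degree u = 1")
        case True
        \<comment> \<open>A special prime divides the linear \<open>m\<close>, hence equals it and
          has order 1; then it divides the linear \<open>u\<close>, which would give
          \<open>u = m\<close>.\<close>
        have "special_primes u m = {}"
        proof (rule ccontr)
          assume "special_primes u m \<noteq> {}"
          then obtain P where P: "P \<in> special_primes u m" by auto
          then have PP: "monic_prime P" "P dvd m"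
            using special_primes_subset by (auto simp: monic_primes_of_def)
          then have "P = m" using M by (simp add: monic_prime_dvd_iff_eq)
          obtain k where k: "k > 0" "m = carlitz_order u P * P ^ k"
            using P unfolding special_primes_def by blast
          have "carlitz_order u P = 1"
          proof (rule monic_degree_0)
            show "lead_coeff (carlitz_order u P) = 1" by (rule lead_coeff_carlitz_order[OF PP(1)])
            then have o0: "carlitz_order u P \<noteq> 0" by auto
            have "degree m = degree (carlitz_order u P) + k * degree P"
              using k(2) o0 monic_primeD(2)[OF PP(1)] by (metis degree_mult_eq degree_power_eq power_eq_0_iff)
            then show "degree (carlitz_order u P) = 0"
              using k(1) 5 \<open>P = m\<close> unfolding e_def by simp
          qed
          then have "P dvd u" using dvd_carlitz_eval_iff[OF PP(1), of 1 u] by simp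
          then have "P = u" using u True \<open>P = m\<close> m 5 by (intro monic_dvd_antisym) (auto simp: e_def)
          then show False using False \<open>P = m\<close> by simp
        qed
        then show ?thesis using zsigmondy_degree_no_special D2 True by (simp add: D_def)
      next
        case False
        then show ?thesis using zge D2 d 5 by linarith
      qed
      then show ?thesis using False 5 by (simp add: e_def)
    qed
  qed
qed

end

section \<open>The exceptional cases\<close>

lemma of_nat_card_eq_0: "(of_nat CARD('a) :: 'a::finite_field) = 0"
  using of_nat_binomial_card_eq_0[of 1, where 'a = 'a] card_finite_field_ge_2[where 'a = 'a] by simp

lemma choose_6: "6 choose 2 = (15 :: nat)" "6 choose 3 = (20 :: nat)"
  by (simp_all add: numeral_eq_Suc)

text \<open>The estimate for two distinct linear primes leaves \<open>q = 6\<close> open. In such a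
  field the binomial coefficients 6, 15 and 20 would vanish, although
  \<open>6 + 15 - 20 = 1\<close>.\<close>

lemma card_neq_6: "CARD('a::finite_field) \<noteq> 6"
proof
  assume q: "CARD('a) = 6"
  have 6: "(6 :: 'a) = 0" using of_nat_card_eq_0[where 'a = 'a] q by simp
  note choose_6
  then have 15: "(15 :: 'a) = 0" and 20: "(20 :: 'a) = 0"
    using of_nat_binomial_card_eq_0[of 2, where 'a = 'a]
      of_nat_binomial_card_eq_0[of 3, where 'a = 'a] q by simp_all
  have "(1 :: 'a) = 6 + 15 - 20" by simp
  then show False unfolding 6 15 20 by simp
qed

lemma UNIV_card_3:
  assumes q: "CARD('a::finite_field) = 3"
  shows "(3 :: 'a) = 0" "(UNIV :: 'a set) = {0, 1, 2}"
proof -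
  show 3: "(3 :: 'a) = 0" using of_nat_card_eq_0[where 'a = 'a] q by simp
  have 2: "(2 :: 'a) \<noteq> 0"
  proof
    assume 2: "(2 :: 'a) = 0"
    have "(1 :: 'a) = 3 - 2" by simp
    then show False unfolding 2 3 by simp
  qed
  have "(2 :: 'a) \<noteq> 1"
  proof
    assume "(2 :: 'a) = 1"
    then have "(1 + 1 :: 'a) = 1 + 0" by simp
    then show False by (simp only: add_left_cancel) simp
  qed
  then have "card {0, 1, 2 :: 'a} = CARD('a)" using 2 q by simp
  then show "(UNIV :: 'a set) = {0, 1, 2}" by (metis card_subset_eq finite subset_UNIV)
qed

lemma UNIV_card_5:
  assumes q: "CARD('a::finite_field) = 5"
  shows "(5 :: 'a) = 0" "(UNIV :: 'a set) = {0, 1, 2, 3, 4}"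
proof -
  show 5: "(5 :: 'a) = 0" using of_nat_card_eq_0[where 'a = 'a] q by simp
  have 2: "(2 :: 'a) \<noteq> 0"
  proof
    assume 2: "(2 :: 'a) = 0"
    have "(1 :: 'a) = 5 - 2 * 2" by simp
    then show False unfolding 2 5 by simp
  qed
  have 3: "(3 :: 'a) \<noteq> 0"
  proof
    assume 3: "(3 :: 'a) = 0"
    have "(1 :: 'a) = 2 * 3 - 5" by simp
    then show False unfolding 3 5 by simp
  qed
  have 4: "(4 :: 'a) \<noteq> 0"
  proof
    assume 4: "(4 :: 'a) = 0"
    have "(1 :: 'a) = 5 - 4" by simp
    then show False unfolding 4 5 by simp
  qed
  have *: "x \<noteq> y" if "x - y = z" "z \<noteq> 0" for x y z :: 'a using that by auto
  have "(2 :: 'a) \<noteq> 1" "(3 :: 'a) \<noteq> 1" "(4 :: 'a) \<noteq> 1" "(3 :: 'a) \<noteq> 2" "(4 :: 'a) \<noteq> 2" "(4 :: 'a) \<noteq> 3"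
    using *[of 2 1 1] *[of 3 1 2] *[of 4 1 3] *[of 3 2 1] *[of 4 2 2] *[of 4 3 1] 2 3 by simp_all
  then have "card {0, 1, 2, 3, 4 :: 'a} = CARD('a)" using 2 3 4 q by simp
  then show "(UNIV :: 'a set) = {0, 1, 2, 3, 4}" by (metis card_subset_eq finite subset_UNIV)
qed

lemma two_eq_0_card_4:
  assumes "CARD('a::finite_field) = 4"
  shows "(2 :: 'a) = 0"
proof -
  have "(4 :: 'a) = 0" using of_nat_card_eq_0[where 'a = 'a] assms by simp
  moreover have "(4 :: 'a) = 2 * 2" by simp
  ultimately show ?thesis by (metis mult_eq_0_iff)
qed

lemma UNIV_card_4:
  assumes q: "CARD('a::finite_field) = 4"
  obtains w where "(w :: 'a::finite_field)\<^sup>2 + w + 1 = 0" "(UNIV :: 'a set) = {0, 1, w, w\<^sup>2}"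
proof -
  have "(UNIV :: 'a set) \<noteq> {0, 1}"
  proof
    assume "(UNIV :: 'a set) = {0, 1}"
    then have "CARD('a) = card {0, 1 :: 'a}" by simp
    then show False using q by simp
  qed
  then obtain w :: 'a where w: "w \<noteq> 0" "w \<noteq> 1" by blast
  have "w ^ 4 = w" using finite_field_power_card_eq_same[of w] q by simp
  moreover have "w ^ 4 - w = w * (w - 1) * (w\<^sup>2 + w + 1)"
    by (simp add: algebra_simps power2_eq_square power4_eq_xxxx)
  ultimately have eq: "w\<^sup>2 + w + 1 = 0" using w by simp
  have "w\<^sup>2 \<noteq> 1"
  proof
    assume "w\<^sup>2 = 1"
    then have "(w - 1) * (w + 1) = 0" by (simp add: algebra_simps power2_eq_square)
    then have "w + 1 = 0" using w by simp
    then have "w = 1" using two_eq_0_card_4[OF q] by (metis add_right_cancel one_add_one)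
    then show False using w by simp
  qed
  moreover have "w\<^sup>2 \<noteq> 0" "w\<^sup>2 \<noteq> w" using w by (auto simp: power2_eq_square)
  ultimately have "card {0, 1, w, w\<^sup>2} = CARD('a)" using w q by auto
  then have "(UNIV :: 'a set) = {0, 1, w, w\<^sup>2}" by (metis card_subset_eq finite subset_UNIV)
  with eq that show ?thesis by blast
qed

section \<open>Moebius sums and special primes in low degree\<close>

context
  fixes ty :: "'a::finite_field itself"
  assumes q: "CARD('a) > 2"
begin

lemma linear_product_monic: "lead_coeff ([:a, 1:] * [:b, 1:] :: 'a poly) = 1" "degree ([:a, 1:] * [:b, 1:] :: 'a poly) = 2"
  "lead_coeff ([:a, 1:] * [:b, 1:] * [:c, 1:] :: 'a poly) = 1" "degree ([:a, 1:] * [:b, 1:] * [:c, 1:] :: 'a poly) = 3"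
  by simp_all

text \<open>\<open>\<phi>(m) = (q - 1)^2\<close> and \<open>\<mu>(m) = 1\<close>, so the numerator
  is \<open>q (q - 2)\<close>.\<close>

lemma moebius_sum_degree_1_distinct:
  fixes a b :: 'a
  assumes "a \<noteq> b"
  shows "moebius_sum ([:a, 1:] * [:b, 1:]) (\<lambda>n. int (degree (carlitz_eval n 1))) = int CARD('a) - 2"
proof (rule moebius_sum_degree_1_eq[OF q])
  have S: "monic_primes_of ([:a, 1:] * [:b, 1:]) = {[:a, 1:], [:b, 1:]}"
    unfolding monic_primes_of_mult by (simp add: monic_primes_of_prime monic_prime_linear insert_commute)
  have q0: "real CARD('a) \<noteq> 0" by simp
  have "totient_poly ([:a, 1:] * [:b, 1:]) = (real CARD('a) - 1)\<^sup>2"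
    unfolding totient_poly_def S linear_product_monic using assms
    by (simp add: field_simps power2_eq_square)
  moreover have "moebius_poly ([:a, 1:] * [:b, 1:]) = 1"
    unfolding moebius_poly_def S using assms by simp
  ultimately show "totient_poly ([:a, 1:] * [:b, 1:]) - real_of_int (moebius_poly ([:a, 1:] * [:b, 1:])) =
      real CARD('a) * real_of_int (int CARD('a) - 2)"
    by (simp add: power2_eq_square algebra_simps)
qed simp

lemma prime_power_neq_prime: "monic_prime R \<Longrightarrow> R \<noteq> R * R" for R :: "'a poly"
  using monic_prime_degree_pos[of R] by (auto simp: degree_mult_eq monic_primeD dest!: arg_cong[of _ _ degree])

text \<open>A repeated prime gives \<open>\<phi>(m) = q (q - 1)\<close> and
  \<open>\<mu>(m) = 0\<close>.\<close>

lemma moebius_sum_degree_1_square: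
  fixes a :: 'a
  shows "moebius_sum ([:a, 1:] * [:a, 1:]) (\<lambda>n. int (degree (carlitz_eval n 1))) = int CARD('a) - 1"
proof (rule moebius_sum_degree_1_eq[OF q])
  have S: "monic_primes_of ([:a, 1:] * [:a, 1:]) = {[:a, 1:]}"
    unfolding monic_primes_of_mult by (simp add: monic_primes_of_prime monic_prime_linear)
  have "totient_poly ([:a, 1:] * [:a, 1:]) = real CARD('a) * (real CARD('a) - 1)"
    unfolding totient_poly_def S linear_product_monic by (simp add: field_simps power2_eq_square)
  moreover have "moebius_poly ([:a, 1:] * [:a, 1:]) = 0"
    unfolding moebius_poly_def S using prime_power_neq_prime[OF monic_prime_linear[of a]]
    by (simp del: mult_pCons_left mult_pCons_right)
  ultimately show "totient_poly ([:a, 1:] * [:a, 1:]) - real_of_int (moebius_poly ([:a, 1:] * [:a, 1:])) =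
      real CARD('a) * real_of_int (int CARD('a) - 1)"
    by simp
qed simp

lemma special_primes_1_degree_2:
  fixes m :: "'a poly"
  assumes m: "lead_coeff m = 1" "degree m = 2" and P: "P \<in> special_primes 1 m"
  shows "degree P = 1 \<and> m = (P - 1) * P"
proof -
  obtain n k where nk: "k > 0" "m = n * P ^ k" "lead_coeff n = 1" "0 < degree n" "degree n \<le> degree P"
    "degree n = 1 \<Longrightarrow> degree P = 1 \<and> n = P - 1"
    using special_primes_1[OF m(1) q P] by metis
  have "n \<noteq> 0" "P \<noteq> 0" using nk by auto
  then have e: "degree n + k * degree P = 2" using nk(2) m(2) by (simp add: degree_mult_eq degree_power_eq)
  have "1 * degree P \<le> k * degree P" using nk(1) by (intro mult_le_mono1) simp
  then have "degree n = 1" using e nk by linarith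
  moreover from this have "k = 1" using e nk(6) by simp
  ultimately show ?thesis using nk by simp
qed

text \<open>If the order \<open>n\<close> had degree at least 2, so would \<open>P\<close>, and the
  total would be at least 4. So \<open>n\<close> is linear, which makes \<open>P\<close> linear with
  \<open>n = P - 1\<close> and leaves \<open>k = 2\<close>.\<close>

lemma special_primes_1_degree_3:
  fixes m :: "'a poly"
  assumes m: "lead_coeff m = 1" "degree m = 3" and P: "P \<in> special_primes 1 m"
  shows "degree P = 1 \<and> m = (P - 1) * P\<^sup>2"
proof -
  obtain n k where nk: "k > 0" "m = n * P ^ k" "lead_coeff n = 1" "0 < degree n" "degree n \<le> degree P"
    "degree n = 1 \<Longrightarrow> degree P = 1 \<and> n = P - 1"
    using special_primes_1[OF m(1) q P] by metis
  have "n \<noteq> 0" "P \<noteq> 0" using nk by auto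
  then have e: "degree n + k * degree P = 3" using nk(2) m(2) by (simp add: degree_mult_eq degree_power_eq)
  have "1 * degree P \<le> k * degree P" using nk(1) by (intro mult_le_mono1) simp
  then have "degree n = 1" using e nk by linarith
  moreover from this have "k = 2" using e nk(6) by simp
  ultimately show ?thesis using nk by simp
qed

lemma not_large_of_linear:
  fixes m :: "'a poly"
  assumes "lead_coeff m = 1" "degree m = 1"
  shows "\<not> zsigmondy_degree 1 m > int (degree m)"
  using zsigmondy_degree_le[OF q, of m 1] moebius_sum_degree_1_prime[OF q assms(1)]
    monic_prime_of_degree_1[OF assms(2,1)] assms by simp

lemma degree_2_cases:
  fixes m :: "'a poly"
  assumes m: "lead_coeff m = 1" "degree m = 2"
  obtains "monic_prime m" | a b where "m = [:a, 1:] * [:b, 1:]"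
proof (cases "monic_prime m")
  case False
  obtain R where R: "monic_prime R" "R dvd m" using monic_prime_divisor_exists[of m] m by auto
  then obtain S where S: "m = R * S" by auto
  then have "S \<noteq> 0" "R \<noteq> 0" using m by auto
  then have d: "degree R + degree S = 2" using S m by (simp add: degree_mult_eq)
  have l: "lead_coeff R = 1" "lead_coeff S = 1"
    using S m(1) monic_primeD(4)[OF R(1)] by (simp_all add: lead_coeff_mult)
  have "degree S \<noteq> 0"
  proof
    assume "degree S = 0"
    then have "S = 1" by (rule monic_degree_0[OF l(2)])
    then show False using S R(1) False by simp
  qed
  then have "degree R = 1" "degree S = 1" using d monic_prime_degree_pos[OF R(1)] by auto
  then show ?thesis using that(2) S l degree_1_monic by metis
qed blast

end

lemma linear_simps:
  "T + 1 = [:1, 1:]" "T + 2 = [:2, 1:]" "T + 3 = [:3, 1:]" "T + 4 = [:4, 1:]"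
  "T - 1 = [:- 1, 1:]" "T + [:c:] = [:c, 1:]" for c :: "'a::finite_field"
  by (simp_all add: one_pCons numeral_poly)

lemma linear_minus_1: "[:c, 1:] - 1 = [:c - 1, 1:]" for c :: "'a::finite_field"
  by (simp add: one_pCons)

lemma monic_prime_degree_1E:
  fixes P :: "'a::finite_field poly"
  assumes "monic_prime P" "degree P = 1"
  obtains c where "P = [:c, 1:]"
  using degree_1_monic[OF assms(2) monic_primeD(4)[OF assms(1)]] that by blast

lemma four_card_5: "CARD('a) = 5 \<Longrightarrow> (4 :: 'a::finite_field) = - 1"
proof -
  assume "CARD('a) = 5"
  then have "(5 :: 'a) = 0" by (rule UNIV_card_5(1))
  moreover have "(4 :: 'a) = 5 - 1" by simp
  ultimately show ?thesis by simp
qed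

lemma two_card_3: "CARD('a) = 3 \<Longrightarrow> (2 :: 'a::finite_field) = - 1"
proof -
  assume "CARD('a) = 3"
  then have "(3 :: 'a) = 0" by (rule UNIV_card_3(1))
  moreover have "(2 :: 'a) = 3 - 1" by simp
  ultimately show ?thesis by simp
qed

section \<open>Exceptional and nonexceptional \<open>m\<close> in degrees two and three\<close>

context
  fixes ty :: "'a::finite_field itself"
  assumes q: "CARD('a) > 2"
begin

text \<open>The Moebius sum \<open>q - 2\<close> is at most 2 for \<open>q = 3\<close> and
  \<open>q = 4\<close>. For \<open>q = 5\<close> it is 3, and the special prime
  \<open>[:b, 1:]\<close> lowers it to 2.\<close>

lemma no_large_distinct:
  fixes a b :: 'a
  assumes "a \<noteq> b" "CARD('a) = 3 \<or> CARD('a) = 4 \<or> CARD('a) = 5 \<and> a = b - 1"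
  shows "\<not> zsigmondy_degree 1 ([:a, 1:] * [:b, 1:]) > int (degree ([:a, 1:] * [:b, 1:]))"
proof (cases "CARD('a) = 5")
  case True
  then have "[:b, 1:] \<in> special_primes 1 (([:b, 1:] - 1) * [:b, 1:] ^ 1)"
    by (intro special_primesI[OF q] monic_prime_linear) auto
  moreover have "([:b, 1:] - 1) * [:b, 1:] ^ 1 = [:a, 1:] * [:b, 1:]"
    using assms True unfolding linear_minus_1 power_one_right by simp
  ultimately have sp: "[:b, 1:] \<in> special_primes 1 ([:a, 1:] * [:b, 1:])" by simp
  show ?thesis
    using zsigmondy_degree_special[OF q linear_product_monic(1)[OF q] sp] True
    unfolding moebius_sum_degree_1_distinct[OF q assms(1)] linear_product_monic(2)[OF q] by simp
next
  case False
  then show ?thesis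
    using zsigmondy_degree_le[OF q linear_product_monic(1)[OF q, of a b], of 1] assms(2)
    unfolding moebius_sum_degree_1_distinct[OF q assms(1)] linear_product_monic(2)[OF q] by auto
qed

lemma no_large_square:
  fixes a :: 'a
  assumes "CARD('a) = 3"
  shows "\<not> zsigmondy_degree 1 ([:a, 1:] * [:a, 1:]) > int (degree ([:a, 1:] * [:a, 1:]))"
  using zsigmondy_degree_le[OF q linear_product_monic(1)[OF q, of a a], of 1] assms
  unfolding moebius_sum_degree_1_square[OF q] linear_product_monic(2)[OF q] by simp

text \<open>\<open>\<phi>(m) = 12\<close> and \<open>\<mu>(m) = 0\<close> give
  \<open>12 / 3 = 4\<close>, and the special prime \<open>P\<close> takes away 1.\<close>

lemma no_large_special_cubic:
  fixes P :: "'a poly"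
  assumes q3: "CARD('a) = 3" and P: "monic_prime P" "degree P = 1"
  shows "\<not> zsigmondy_degree 1 ((P - 1) * P\<^sup>2) > int (degree ((P - 1) * P\<^sup>2))"
proof -
  obtain c where c: "P = [:c, 1:]" using P by (rule monic_prime_degree_1E)
  have sp: "P \<in> special_primes 1 ((P - 1) * P\<^sup>2)" by (rule special_primesI[OF q P]) simp
  have m: "(P - 1) * P\<^sup>2 = [:c - 1, 1:] * [:c, 1:] * [:c, 1:]"
    unfolding c linear_minus_1 power2_eq_square mult.assoc ..
  let ?m = "[:c - 1, 1:] * [:c, 1:] * [:c, 1:]"
  have S: "monic_primes_of ?m = {[:c - 1, 1:], [:c, 1:]}"
    unfolding monic_primes_of_mult by (simp add: monic_primes_of_prime monic_prime_linear insert_commute)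
  have tot: "totient_poly ?m = 12"
    unfolding totient_poly_def S linear_product_monic(4)[OF q] by (simp add: q3)
  have "\<Prod>{[:c - 1, 1:], [:c, 1:]} = [:c - 1, 1:] * [:c, 1:]" by (subst prod.insert) auto
  then have "degree (\<Prod>(monic_primes_of ?m)) = 2"
    unfolding S by (simp only: linear_product_monic(2)[OF q])
  then have mu: "moebius_poly ?m = 0"
    unfolding moebius_poly_def using linear_product_monic(4)[OF q, of "c - 1" c c] by auto
  have "moebius_sum ?m (\<lambda>n. int (degree (carlitz_eval n 1))) = 4"
    by (rule moebius_sum_degree_1_eq[OF q linear_product_monic(3)[OF q]]) (simp add: tot mu q3 del: mult_pCons_left mult_pCons_right)
  then show ?thesis
    using zsigmondy_degree_special[OF q linear_product_monic(3)[OF q] sp[unfolded m]] P(2)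
    unfolding m linear_product_monic(4)[OF q] by simp
qed

text \<open>In characteristic 3 the cubic is \<open>T ^ 3 - T\<close>, which vanishes on the whole
  field and so is the product of all linear primes.\<close>

lemma card_3_linear_product:
  assumes q3: "CARD('a) = 3"
  defines "S \<equiv> {[:0, 1:], [:1, 1:], [:2, 1:] :: 'a poly}"
  shows "card S = 3" "\<Prod>S = [:0, 1:] * [:1, 1:] * [:2, 1:]" "T ^ 3 + 2 * T = \<Prod>S"
proof -
  have "(2 :: 'a) \<noteq> 0" "(2 :: 'a) \<noteq> 1"
  proof -
    have "card {0, 1, 2 :: 'a} = 3" using UNIV_card_3(2)[OF q3] q3 by metis
    then show "(2 :: 'a) \<noteq> 0" "(2 :: 'a) \<noteq> 1" by (auto simp: card_insert_if split: if_splits)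
  qed
  then show "card S = 3" "\<Prod>S = [:0, 1:] * [:1, 1:] * [:2, 1:]"
    by (simp_all add: S_def del: mult_pCons_left mult_pCons_right)
  then show "T ^ 3 + 2 * T = \<Prod>S"
    using UNIV_card_3(1)[OF q3] by (simp add: power3_eq_cube numeral_poly)
qed

text \<open>\<open>\<phi>(m) = 8\<close> and \<open>\<mu>(m) = -1\<close> give
  \<open>9 / 3 = 3\<close>, which only equals the degree.\<close>

lemma no_large_three_linear:
  assumes q3: "CARD('a) = 3"
  shows "\<not> zsigmondy_degree 1 (T ^ 3 + 2 * T :: 'a poly) > int (degree (T ^ 3 + 2 * T :: 'a poly))"
proof -
  let ?S = "{[:0, 1:], [:1, 1:], [:2, 1:] :: 'a poly}"
  let ?m = "[:0, 1:] * [:1, 1:] * [:2, 1:] :: 'a poly"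
  note S = card_3_linear_product[OF q3]
  have m: "T ^ 3 + 2 * T = ?m" unfolding S(3) S(2) ..
  have mS: "monic_primes_of ?m = ?S"
    unfolding monic_primes_of_mult by (simp add: monic_primes_of_prime monic_prime_linear insert_commute)
  have "(\<Prod>R\<in>?S. 1 - 1 / real CARD('a) ^ degree R) = (\<Prod>R\<in>?S. 2 / 3)"
    by (rule prod.cong) (auto simp: q3)
  also have "\<dots> = (2 / 3) ^ 3" unfolding prod_constant S(1) ..
  finally have tot: "totient_poly ?m = 8"
    unfolding totient_poly_def mS linear_product_monic(4)[OF q] by (simp add: q3 power3_eq_cube)
  have mu: "moebius_poly ?m = - 1" unfolding moebius_poly_def mS S(1) S(2) by simp
  have "moebius_sum ?m (\<lambda>n. int (degree (carlitz_eval n 1))) = 3"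
    by (rule moebius_sum_degree_1_eq[OF q linear_product_monic(3)[OF q]]) (simp add: tot mu q3 del: mult_pCons_left mult_pCons_right)
  then show ?thesis
    using zsigmondy_degree_le[OF q linear_product_monic(3)[OF q, of 0 1 2], of 1] unfolding m linear_product_monic(4)[OF q] by simp
qed

lemma large_cubic_card_3:
  fixes m :: "'a poly"
  assumes q3: "CARD('a) = 3" and m: "lead_coeff m = 1" and e: "degree m = 3"
    and ns: "\<not> (\<exists>P. monic_prime P \<and> degree P = 1 \<and> m = (P - 1) * P\<^sup>2)"
    and nt: "m \<noteq> T ^ 3 + 2 * T"
  shows "zsigmondy_degree 1 m > 3"
proof -
  let ?S = "{[:0, 1:], [:1, 1:], [:2, 1:] :: 'a poly}"
  note S = card_3_linear_product[OF q3]
  have "special_primes 1 m = {}"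
  proof (rule ccontr)
    assume "special_primes 1 m \<noteq> {}"
    then obtain P where P: "P \<in> special_primes 1 m" by blast
    then have "monic_prime P" by (simp add: special_primes_def)
    with special_primes_1_degree_3[OF q m e P] ns show False by blast
  qed
  then have z: "zsigmondy_degree 1 m = moebius_sum m (\<lambda>n. int (degree (carlitz_eval n 1)))"
    by (rule zsigmondy_degree_no_special[OF q m])
  define L where "L = {R \<in> monic_primes_of m. degree R = 1}"
  obtain b where b: "card L \<le> 3" "card L + 2 * b \<le> 3"
    "3 ^ 3 * (2 / 3) ^ card L * (8 / 9) ^ b \<le> totient_poly m"
    "b = 0 \<Longrightarrow> monic_primes_of m = L"
    using totient_poly_ge_card_3[OF q m q3] unfolding e L_def by blast
  have "card L \<noteq> 3"
  proof
    assume L3: "card L = 3"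
    have "L \<subseteq> ?S"
    proof
      fix R assume "R \<in> L"
      then have "monic_prime R" "degree R = 1" by (auto simp: L_def monic_primes_of_def)
      then obtain c where "R = [:c, 1:]" by (rule monic_prime_degree_1E)
      moreover have "c \<in> {0, 1, 2}" using UNIV_card_3(2)[OF q3] by blast
      ultimately show "R \<in> ?S" by auto
    qed
    then have "L = ?S" using L3 S(1) by (intro card_subset_eq) auto
    then have sub: "?S \<subseteq> monic_primes_of m" by (auto simp: L_def)
    have "m = \<Prod>?S"
      using moebius_sum_subset(2,3)[OF m sub] m e linear_product_monic(4)[OF q, of 0 1 2]
      by (intro monic_dvd_antisym[symmetric]) (simp_all only: S(2) order.refl)
    then show False using nt S(3) by simp
  qed
  define a where "a = card L"
  have "a = 0 \<or> a = 1 \<or> a = 2" "b = 0 \<or> b = 1" "a + 2 * b \<le> 3"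
    using b \<open>card L \<noteq> 3\<close> unfolding a_def by linarith+
  \<comment> \<open>The minimum 12 occurs at \<open>a = 2\<close> and \<open>b = 0\<close>. With
    \<open>\<bar>\<mu>(m)\<bar> \<le> 1\<close> the numerator exceeds \<open>9 = 3 * 3\<close>, and
    no special prime reduces it.\<close>
  then have "12 \<le> 3 ^ 3 * (2 / 3 :: real) ^ a * (8 / 9) ^ b"
    by (elim disjE) (simp_all add: power2_eq_square)
  then have "12 \<le> totient_poly m" using b(3) unfolding a_def by linarith
  then have "moebius_sum m (\<lambda>n. int (degree (carlitz_eval n 1))) > 3"
    using moebius_poly_le[of m] by (intro moebius_sum_degree_1_gr[OF q m]) (simp add: q3)
  then show ?thesis using z by simp
qed

text \<open>The Moebius sum is \<open>q\<close> for a prime, \<open>q - 1\<close> for a square and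
  \<open>q - 2\<close> for two distinct linear primes. In the last case special primes cost at most
  2, so \<open>q \<le> 6\<close>; for \<open>q = 5\<close> the value 3 fails only if some special
  prime \<open>P\<close> exists, and then \<open>m = (P - 1) * P\<close>.\<close>

lemma large_quadratic:
  fixes m :: "'a poly"
  assumes m: "lead_coeff m = 1" and e: "degree m = 2" and nl: "\<not> zsigmondy_degree 1 m > 2"
  obtains (distinct_3_4) a b where "CARD('a) = 3 \<or> CARD('a) = 4" "m = [:a, 1:] * [:b, 1:]" "a \<noteq> b"
    | (square) a where "CARD('a) = 3" "m = [:a, 1:] * [:a, 1:]"
    | (special) b where "CARD('a) = 5" "m = [:b - 1, 1:] * [:b, 1:]"
proof (rule degree_2_cases[OF q m e])
  assume M: "monic_prime m"
  have "special_primes 1 m = {}"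
  proof (rule ccontr)
    assume "special_primes 1 m \<noteq> {}"
    then obtain P where P: "P \<in> special_primes 1 m" by blast
    then have "monic_prime P" "P dvd m" using special_primes_subset by (auto simp: monic_primes_of_def)
    then have "P = m" using M by (simp add: monic_prime_dvd_iff_eq)
    with special_primes_1_degree_2[OF q m e P] e show False by simp
  qed
  then have "zsigmondy_degree 1 m = int CARD('a)"
    using zsigmondy_degree_no_special[OF q m, of 1] moebius_sum_degree_1_prime[OF q m M] e by simp
  then show ?thesis using nl q by simp
next
  fix a b assume mab: "m = [:a, 1:] * [:b, 1:]"
  show ?thesis
  proof (cases "a = b")
    case True
    have "special_primes 1 m = {}"
    proof (rule ccontr)
      assume "special_primes 1 m \<noteq> {}"
      then obtain P where P: "P \<in> special_primes 1 m" by blast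
      then have "P \<in> monic_primes_of m" using special_primes_subset by blast
      then have Pa: "P = [:a, 1:]" using True unfolding mab monic_primes_of_mult
        by (simp add: monic_primes_of_prime monic_prime_linear)
      have "m = [:a - 1, 1:] * [:a, 1:]"
        using special_primes_1_degree_2[OF q m e P] unfolding Pa linear_minus_1 by blast
      then have "[:a, 1:] * [:a, 1:] = [:a - 1, 1:] * [:a, 1:]" using mab True by simp
      then show False by (simp only: mult_cancel_right) simp
    qed
    then have "zsigmondy_degree 1 m = int CARD('a) - 1"
      using zsigmondy_degree_no_special[OF q m, of 1] moebius_sum_degree_1_square[OF q, of a]
      unfolding mab True by simp
    then have "CARD('a) = 3" using nl q by linarith
    then show ?thesis using square mab True by blast
  next
    case False
    have D: "moebius_sum m (\<lambda>n. int (degree (carlitz_eval n 1))) = int CARD('a) - 2"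
      unfolding mab by (rule moebius_sum_degree_1_distinct[OF q False])
    then have "int CARD('a) - 4 \<le> 2"
      using zsigmondy_degree_ge[OF q m, of 1] nl e by simp
    then have "CARD('a) \<le> 6" by simp
    then consider "CARD('a) = 3 \<or> CARD('a) = 4" | "CARD('a) = 5"
      using card_neq_6[where 'a = 'a] q by linarith
    then show ?thesis
    proof cases
      case 1
      then show ?thesis using distinct_3_4 mab False by blast
    next
      case 2
      have "special_primes 1 m \<noteq> {}"
        using zsigmondy_degree_no_special[OF q m, of 1] D nl 2 by auto
      then obtain P where P: "P \<in> special_primes 1 m" by blast
      then have "monic_prime P" by (simp add: special_primes_def)
      then obtain c where c: "P = [:c, 1:]"
        using monic_prime_degree_1E special_primes_1_degree_2[OF q m e P] by blast
      have "m = [:c - 1, 1:] * [:c, 1:]"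
        using special_primes_1_degree_2[OF q m e P] unfolding c linear_minus_1 by blast
      then show ?thesis using special 2 by blast
    qed
  qed
qed

end

text \<open>Of the six pairs of distinct field elements, \<open>{0, 1}\<close> and
  \<open>{w, w^2}\<close> differ by 1 and give \<open>(P - 1) * P\<close>; the other four are the
  listed products.\<close>

lemma card_4_quadratic:
  fixes a b w :: "'a::finite_field"
  assumes q: "CARD('a) = 4" and ab: "a \<noteq> b" and m: "m = [:a, 1:] * [:b, 1:]"
    and w: "w\<^sup>2 + w + 1 = 0" and U: "(UNIV :: 'a set) = {0, 1, w, w\<^sup>2}"
  shows "(\<exists>P. monic_prime P \<and> degree P = 1 \<and> m = (P - 1) * P) \<or>
    m \<in> {T * (T + [:w:]), T * (T + [:w^2:]), (T + 1) * (T + [:w:]), (T + 1) * (T + [:w^2:])}"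
proof -
  have two: "(2 :: 'a) = 0" by (rule two_eq_0_card_4[OF q])
  have neg: "- x = x" for x :: 'a
  proof -
    have "x + x = 2 * x" by simp
    then have "x + x = 0" using two by simp
    then show ?thesis by (simp add: minus_unique)
  qed
  have w2: "w\<^sup>2 - 1 = w"
    using w neg[of 1] neg[of w] by (metis add.commute add.left_commute add_eq_0_iff diff_conv_add_uminus)
  have I: "\<exists>P. monic_prime P \<and> degree P = 1 \<and> m = (P - 1) * P" if "m = [:d - 1, 1:] * [:d, 1:]" for d
    using that by (intro exI[of _ "[:d, 1:]"]) (simp add: monic_prime_linear linear_minus_1 del: mult_pCons_left mult_pCons_right)
  have c: "m = [:b, 1:] * [:a, 1:]" unfolding m by (rule mult.commute)
  have "a \<in> {0, 1, w, w\<^sup>2}" "b \<in> {0, 1, w, w\<^sup>2}" using U by blast+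
  then show ?thesis
    using ab m c I[of 1] I[of "w\<^sup>2"] unfolding linear_simps w2 diff_self
    by (elim insertE emptyE) (simp_all del: mult_pCons_left mult_pCons_right)
qed

theorem theorem6p16:
  fixes m u :: "'a::finite_field poly"
  assumes "CARD('a) > 2"
    and "lead_coeff m = 1" and "lead_coeff u = 1"
    and "degree m > 0 \<or> degree u > 0"
  shows "(\<exists>P. large_zsigmondy_prime u m P) \<longleftrightarrow> \<not>
    (CARD('a) = 3 \<and> u = 1 \<and> (\<exists>P. monic_prime P \<and> degree P = 1 \<and> m = (P - 1) * P)
   \<or> CARD('a) = 4 \<and> u = 1 \<and> (\<exists>P. monic_prime P \<and> degree P = 1 \<and> m = (P - 1) * P)
   \<or> CARD('a) = 3 \<and> u = 1 \<and> m \<in> {(T - 1) * T^2, T * (T + 1)^2, (T + 1) * (T + 2)^2}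
   \<or> CARD('a) = 3 \<and> u = m \<and> m \<in> {T, T + 1, T + 2}
   \<or> CARD('a) = 5 \<and> u = 1 \<and> m \<in> {T * (T + 1), (T + 1) * (T + 2), (T + 2) * (T + 3),
                                   (T + 3) * (T + 4), (T + 4) * T}
   \<or> u = 1 \<and> monic_prime m \<and> degree m = 1
   \<or> CARD('a) = 3 \<and> u = 1 \<and> m \<in> {T^2, (T + 1)^2, (T + 2)^2}
   \<or> CARD('a) = 4 \<and> u = 1 \<and> (\<exists>w::'a. w^2 + w + 1 = 0 \<and>
        m \<in> {T * (T + [:w:]), T * (T + [:w^2:]), (T + 1) * (T + [:w:]), (T + 1) * (T + [:w^2:])})
   \<or> CARD('a) = 3 \<and> u = 1 \<and> m = T^3 + 2 * T)"
  (is "_ \<longleftrightarrow> \<not> (?E1 \<or> ?E2 \<or> ?E3 \<or> ?E4 \<or> ?E5 \<or> ?E6 \<or> ?E7 \<or> ?E8 \<or> ?E9)")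
proof -
  note q = assms(1) and m = assms(2) and u = assms(3)
  note no_mult = mult_pCons_left mult_pCons_right
  have linear_card_3: "m \<in> {T, T + 1, T + 2} \<longleftrightarrow> degree m = 1" if q3: "CARD('a) = 3"
  proof
    assume "degree m = 1"
    then have "m = [:coeff m 0, 1:]" using m by (rule degree_1_monic)
    moreover have "coeff m 0 \<in> {0, 1, 2}" using UNIV_card_3(2)[OF q3] by blast
    ultimately show "m \<in> {T, T + 1, T + 2}" unfolding linear_simps by auto
  qed (auto simp: linear_simps)
  have "zsigmondy_degree u m > int (degree m) \<longleftrightarrow>
    \<not> (?E1 \<or> ?E2 \<or> ?E3 \<or> ?E4 \<or> ?E5 \<or> ?E6 \<or> ?E7 \<or> ?E8 \<or> ?E9)"
  proof (cases "degree u = 0")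
    case False
    then have "u \<noteq> 1" by auto
    then show ?thesis
      using large_zsigmondy_u_nonconst[OF q m u] False linear_card_3 by auto
  next
    case True
    then have u1: "u = 1" using u by (intro monic_degree_0)
    then have d: "degree m > 0" using assms(4) by simp
    then have "u \<noteq> m" using u1 by auto
    let ?N = "\<lambda>m. \<not> zsigmondy_degree 1 m > int (degree m)"
    have pair: "?N ([:a, 1:] * [:b, 1:])"
      if "CARD('a) = 3 \<or> CARD('a) = 4 \<or> CARD('a) = 5 \<and> a = b - 1" "a \<noteq> b" for a b :: 'a
      using no_large_distinct[OF q that(2,1)] .
    have P_pair: "?N m" if q34: "CARD('a) = 3 \<or> CARD('a) = 4" and
      ex: "\<exists>P. monic_prime P \<and> degree P = 1 \<and> m = (P - 1) * P"
    proof -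
      obtain P where P: "monic_prime P" "degree P = 1" "m = (P - 1) * P" using ex by blast
      then obtain c where "P = [:c, 1:]" using monic_prime_degree_1E by blast
      then have "m = [:c - 1, 1:] * [:c, 1:]" using P(3) unfolding linear_minus_1[symmetric] by simp
      then show ?thesis using pair[of "c - 1" c] q34 by (auto simp del: no_mult)
    qed
    have E5: "?N m" if E: ?E5
    proof -
      have q5: "CARD('a) = 5" using E by simp
      \<comment> \<open>\<open>(T + 4) * T\<close> follows the pattern \<open>(P - 1) * P\<close> at
        \<open>P = T\<close>, because \<open>4 = -1\<close>.\<close>
      have m4: "[:4, 1:] * [:0, 1:] = [:0 - 1, 1:] * [:0, 1 :: 'a:]"
        using four_card_5[OF q5] by (simp del: no_mult)
      have "m \<in> (\<lambda>c. [:c - 1, 1:] * [:c, 1:]) ` {1, 2, 3, 4, 0}"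
        using E unfolding linear_simps m4 by (simp del: no_mult)
      then obtain c where c: "m = [:c - 1, 1:] * [:c, 1:]" by blast
      show ?thesis using pair[of "c - 1" c] q5 unfolding c by (simp del: no_mult)
    qed
    have E8: "?N m" if E: ?E8
    proof -
      have q4: "CARD('a) = 4" using E by simp
      obtain w :: 'a where w: "w\<^sup>2 + w + 1 = 0" and mw:
        "m \<in> {T * (T + [:w:]), T * (T + [:w^2:]), (T + 1) * (T + [:w:]), (T + 1) * (T + [:w^2:])}"
        using E by blast
      have two: "(2 :: 'a) = 0" by (rule two_eq_0_card_4[OF q4])
      \<comment> \<open>In characteristic 2 neither \<open>w\<close> nor \<open>w^2\<close> is 0 or
        1, so each listed product has two distinct linear factors.\<close>
      have "w \<noteq> 0" using w by auto
      moreover have "w \<noteq> 1" using w two by auto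
      moreover have "w\<^sup>2 \<noteq> 1"
      proof
        assume "w\<^sup>2 = 1"
        then have "2 + w = 0" using w by (simp add: add.commute add.left_commute)
        then show False using two \<open>w \<noteq> 0\<close> by simp
      qed
      ultimately have "\<exists>a b. a \<noteq> b \<and> m = [:a, 1:] * [:b, 1:]"
        using mw unfolding linear_simps by (metis empty_iff insert_iff power_eq_0_iff)
      then show ?thesis using pair q4 by blast
    qed
    have E3: "(\<exists>P. monic_prime P \<and> degree P = 1 \<and> m = (P - 1) * P\<^sup>2) \<longleftrightarrow> ?E3" if q3: "CARD('a) = 3"
    proof
      assume "\<exists>P. monic_prime P \<and> degree P = 1 \<and> m = (P - 1) * P\<^sup>2"
      then obtain P where P: "monic_prime P" "degree P = 1" "m = (P - 1) * P\<^sup>2" by blast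
      then obtain c where c: "P = [:c, 1:]" using monic_prime_degree_1E by blast
      have mc: "m = [:c - 1, 1:] * [:c, 1:]\<^sup>2" using P(3) unfolding c linear_minus_1 .
      have "c \<in> {0, 1, 2}" using UNIV_card_3(2)[OF q3] by blast
      then show ?E3 using mc q3 u1 unfolding linear_simps
        by (elim insertE emptyE) (simp_all del: no_mult)
    next
      assume ?E3
      moreover have "(1 :: 'a) = 2 - 1" by simp
      ultimately have "m \<in> {[:0 - 1, 1:] * [:0, 1:]\<^sup>2, [:1 - 1, 1:] * [:1, 1:]\<^sup>2, [:2 - 1, 1:] * [:2, 1:]\<^sup>2}"
        unfolding linear_simps by (simp del: no_mult)
      then obtain c where "m = ([:c, 1:] - 1) * [:c, 1:]\<^sup>2" unfolding linear_minus_1 by blast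
      then show "\<exists>P. monic_prime P \<and> degree P = 1 \<and> m = (P - 1) * P\<^sup>2"
        using monic_prime_linear[of c] by (intro exI[of _ "[:c, 1:]"]) (simp del: no_mult)
    qed
    have sq: "m \<in> {T\<^sup>2, (T + 1)\<^sup>2, (T + 2)\<^sup>2} \<longleftrightarrow> (\<exists>a. m = [:a, 1:] * [:a, 1:])" if q3: "CARD('a) = 3"
    proof
      assume "\<exists>a. m = [:a, 1:] * [:a, 1:]"
      then obtain a where "m = [:a, 1:] * [:a, 1:]" by blast
      moreover have "a \<in> {0, 1, 2}" using UNIV_card_3(2)[OF q3] by blast
      ultimately show "m \<in> {T\<^sup>2, (T + 1)\<^sup>2, (T + 2)\<^sup>2}" unfolding linear_simps power2_eq_square by blast
    qed (unfold linear_simps power2_eq_square, blast)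
    have exceptional: "?N m" if "?E1 \<or> ?E2 \<or> ?E3 \<or> ?E4 \<or> ?E5 \<or> ?E6 \<or> ?E7 \<or> ?E8 \<or> ?E9"
      using that
    proof (elim disjE)
      assume E: ?E3
      then have q3: "CARD('a) = 3" by (rule conjunct1)
      obtain P where P: "monic_prime P" "degree P = 1" "m = (P - 1) * P\<^sup>2" using E E3[OF q3] by blast
      show ?thesis using no_large_special_cubic[OF q q3 P(1,2)] unfolding P(3) .
    next
      assume ?E6
      then show ?thesis using not_large_of_linear[OF q m] by blast
    next
      assume E: ?E7
      then have q3: "CARD('a) = 3" by (rule conjunct1)
      obtain a where "m = [:a, 1:] * [:a, 1:]" using E sq[OF q3] by blast
      then show ?thesis using no_large_square[OF q q3, of a] by (simp only: not_False_eq_True)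
    next
      assume ?E9
      then show ?thesis using no_large_three_linear[OF q] by blast
    qed (use P_pair E5 E8 \<open>u \<noteq> m\<close> in blast)+
    have nonexceptional: "?E1 \<or> ?E2 \<or> ?E3 \<or> ?E4 \<or> ?E5 \<or> ?E6 \<or> ?E7 \<or> ?E8 \<or> ?E9" if N: "?N m"
    proof -
      have "degree m < 5" "degree m = 4 \<longrightarrow> CARD('a) \<noteq> 3" "3 \<le> degree m \<longrightarrow> \<not> 3 < CARD('a)"
        using N large_zsigmondy_of_large[OF q m] large_zsigmondy_card_3_degree_4[OF q m]
        by (meson not_le)+
      then consider "degree m = 1" | "degree m = 2" | "degree m = 3" "CARD('a) = 3"
        using d q by linarith
      then show ?thesis
      proof cases
        case 1
        then show ?thesis using u1 m monic_prime_of_degree_1 by blast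
      next
        case 2
        then have "\<not> zsigmondy_degree 1 m > 2" using N by simp
        then show ?thesis
        proof (rule large_quadratic[OF q m 2])
          fix a b assume q34: "CARD('a) = 3 \<or> CARD('a) = 4" and mab: "m = [:a, 1:] * [:b, 1:]"
            and ab: "a \<noteq> b"
          show ?thesis
          proof (cases "CARD('a) = 3")
            case True
            \<comment> \<open>Distinct elements of a field with three elements differ by 1 or -1, so
              every product of two distinct linear primes has the form
              \<open>(P - 1) * P\<close>.\<close>
            have "a = b - 1 \<or> b = a - 1"
            proof -
              have "a \<in> {0, 1, 2}" "b \<in> {0, 1, 2}" using UNIV_card_3(2)[OF True] by blast+
              then show ?thesis using ab two_card_3[OF True] by (elim insertE emptyE) simp_all
            qed
            moreover have "m = [:b, 1:] * [:a, 1:]" unfolding mab by (rule mult.commute)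
            ultimately obtain c where "m = ([:c, 1:] - 1) * [:c, 1:]"
              using mab unfolding linear_minus_1 by blast
            then show ?thesis using True u1 monic_prime_linear[of c]
              by (metis degree_pCons_eq_if degree_1 one_neq_zero One_nat_def degree_pCons_0 one_pCons)
          next
            case False
            then have q4: "CARD('a) = 4" using q34 by simp
            obtain w :: 'a where "w\<^sup>2 + w + 1 = 0" "(UNIV :: 'a set) = {0, 1, w, w\<^sup>2}"
              by (rule UNIV_card_4[OF q4])
            with card_4_quadratic[OF q4 ab mab] show ?thesis using q4 u1 by blast
          qed
        next
          fix a assume "CARD('a) = 3" "m = [:a, 1:] * [:a, 1:]"
          then show ?thesis using sq u1 by blast
        next
          fix b assume q5: "CARD('a) = 5" and mb: "m = [:b - 1, 1:] * [:b, 1:]"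
          have "b \<in> {0, 1, 2, 3, 4}" using UNIV_card_5(2)[OF q5] by blast
          with mb have "m \<in> {[:0 - 1, 1:] * [:0, 1:], [:1 - 1, 1:] * [:1, 1:],
            [:2 - 1, 1:] * [:2, 1:], [:3 - 1, 1:] * [:3, 1:], [:4 - 1, 1:] * [:4, 1:]}" by blast
          moreover have "0 - 1 = (4 :: 'a)" "1 - 1 = (0 :: 'a)" "2 - 1 = (1 :: 'a)"
            "3 - 1 = (2 :: 'a)" "4 - 1 = (3 :: 'a)"
            using four_card_5[OF q5] by simp_all
          ultimately have ?E5
            using q5 u1 unfolding linear_simps by (simp only: insert_iff empty_iff simp_thms) blast
          then show ?thesis by blast
        qed
      next
        case 3
        then show ?thesis using N large_cubic_card_3[OF q 3(2) m 3(1)] E3[OF 3(2)] u1 by auto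
      qed
    qed
    have z: "zsigmondy_degree u m = zsigmondy_degree 1 m" using u1 by simp
    show ?thesis unfolding z
    proof (rule iffI)
      assume "zsigmondy_degree 1 m > int (degree m)"
      then show "\<not> (?E1 \<or> ?E2 \<or> ?E3 \<or> ?E4 \<or> ?E5 \<or> ?E6 \<or> ?E7 \<or> ?E8 \<or> ?E9)"
        using exceptional by (rule contrapos_pn)
    next
      assume "\<not> (?E1 \<or> ?E2 \<or> ?E3 \<or> ?E4 \<or> ?E5 \<or> ?E6 \<or> ?E7 \<or> ?E8 \<or> ?E9)"
      then show "zsigmondy_degree 1 m > int (degree m)"
        using nonexceptional by (rule contrapos_np)
    qed
  qed
  then show ?thesis unfolding large_zsigmondy_iff[OF q m u] .
qed

end
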